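(* Let $\varphi$ be a nontrivial endomorphism of a torsion-free co-hopfian hyperbolic group $G$ (nontrivial meaning $G\varphi\neq 1$) and let $d \in V^A(p,\gamma,T)$ be a visual metric on $G$, where $A$ is a finite generating set of $G$, $p\in G$, $\gamma>0$ and $T\geq 1$. Then the following conditions are equivalent: (i) $\varphi$ is uniformly continuous with respect to $d$; (ii) $\varphi$ satisfies a Hölder condition with respect to $d$; (iii) $\varphi$ admits a continuous extension to the completion $(\widehat{G},\widehat{d})$; (iv) $\varphi$ admits an extension to $\widehat{G}$ satisfying a Hölder condition with respect to $\widehat{d}$; (v) there exist constants $P > 0$ and $Q \in \mathbb{R}$ such that $P(g\varphi|h\varphi)_p^A + Q \geq (g|h)_p^A$ for all $g,h \in G$; (vi) $\varphi$ is a quasi-isometric embedding of $(G,d_A)$ into itself; (vii) $\varphi$ is virtually injective; (viii) $\varphi$ is an automorphism.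
   Context: Maps are written on the right. All generating sets are finite. A group $G$ is co-hopfian if every injective endomorphism of $G$ is an automorphism. For $G = \langle A\rangle$, $\widetilde{A} = A \cup A^{-1}$, and $d_A(g,h)$ is the length of a shortest path from $g$ to $h$ in the Cayley graph $\Gamma_A(G)$ (vertex set $G$, edges $g \to ga$ for $a \in \widetilde{A}$). $G$ is hyperbolic if the geometric realization of $\Gamma_A(G)$ (edges of length 1) is $\delta$-hyperbolic for some $\delta \ge 0$ (every side of every geodesic triangle lies in the closed $\delta$-neighbourhood of the union of the other two sides); this does not depend on $A$. Gromov product: $(g|h)_p^A = \frac12(d_A(p,g)+d_A(p,h)-d_A(g,h))$ for $g,h,p\in G$. Let $\rho^A_{p,\gamma}(g,h) = e^{-\gamma (g|h)_p^A}$ if $g \ne h$ and $0$ otherwise. For $p \in G$, $\gamma>0$, $T\ge 1$, $V^A(p,\gamma,T)$ is the set of all metrics $d$ on $G$ with $\frac1T\rho^A_{p,\gamma}(g,h) \le d(g,h) \le T\rho^A_{p,\gamma}(g,h)$ for all distinct $g,h\in G$; the metrics in such sets are called visual metrics. $(\widehat{G},\widehat{d})$ denotes the metric completion of $(G,d)$ (so $\widehat{G} = G \cup \partial G$, where $\partial G$ is the Gromov boundary). A map $\varphi:(X,d)\to(X',d')$ satisfies a Hölder condition of exponent $r>0$ if there is $K>0$ with $d'(x\varphi,y\varphi)\le K\,d(x,y)^r$ for all $x,y\in X$; it satisfies a Hölder condition if this holds for some $r>0$. It is a quasi-isometric embedding if there are $\lambda\ge1$, $K\ge0$ with $\frac1\lambda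 d(x,y)-K\le d'(x\varphi,y\varphi)\le\lambda d(x,y)+K$ for all $x,y\in X$. An endomorphism is virtually injective if its kernel is finite. *)

theory Defs
  imports "HOL-Analysis.Analysis" "HOL-Algebra.Coset" "HOL-Algebra.Generated_Groups"
begin

section \<open>Groups\<close>

definition torsion_free :: "('a, 'm) monoid_scheme \<Rightarrow> bool" where
  "torsion_free G \<longleftrightarrow>
     (\<forall>g\<in>carrier G. \<forall>n::nat. n > 0 \<longrightarrow> g [^]\<^bsub>G\<^esub> n = \<one>\<^bsub>G\<^esub> \<longrightarrow> g = \<one>\<^bsub>G\<^esub>)"

definition co_hopfian :: "('a, 'm) monoid_scheme \<Rightarrow> bool" where
  "co_hopfian G \<longleftrightarrow> (\<forall>\<psi>\<in>hom G G. inj_on \<psi> (carrier G) \<longrightarrow> \<psi> \<in> iso G G)"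

definition virtually_injective :: "('a, 'm) monoid_scheme \<Rightarrow> ('a \<Rightarrow> 'a) \<Rightarrow> bool" where
  "virtually_injective G \<phi> \<longleftrightarrow> finite (kernel G G \<phi>)"

definition finite_generating_set :: "('a, 'm) monoid_scheme \<Rightarrow> 'a set \<Rightarrow> bool" where
  "finite_generating_set G A \<longleftrightarrow> finite A \<and> A \<subseteq> carrier G \<and> generate G A = carrier G"

section \<open>The Cayley graph and its word metric\<close>

definition sym_gens :: "('a, 'm) monoid_scheme \<Rightarrow> 'a set \<Rightarrow> 'a set" where
  "sym_gens G A = A \<union> m_inv G ` A"

definition cayley_path ::
  "('a, 'm) monoid_scheme \<Rightarrow> 'a set \<Rightarrow> nat \<Rightarrow> (nat \<Rightarrow> 'a) \<Rightarrow> bool" where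
  "cayley_path G A n c \<longleftrightarrow>
     (\<forall>i\<le>n. c i \<in> carrier G) \<and>
     (\<forall>i<n. \<exists>a\<in>sym_gens G A. c (Suc i) = c i \<otimes>\<^bsub>G\<^esub> a)"

definition word_dist :: "('a, 'm) monoid_scheme \<Rightarrow> 'a set \<Rightarrow> 'a \<Rightarrow> 'a \<Rightarrow> real" where
  "word_dist G A g h = real (LEAST n. \<exists>c. cayley_path G A n c \<and> c 0 = g \<and> c n = h)"

section \<open>The geometric realization of the Cayley graph\<close>

text \<open>
  A point of the realization is given by its barycentric coordinates, a function on the vertices
  supported on a single vertex or on the two endpoints of an edge. Mutually inverse edges
  \<open>g \<rightarrow> g a\<close> and \<open>g a \<rightarrow> g\<close> are the same edge; the loops that arise when the identity belongs to
  the generating set are degenerate and collapse to their vertex. The vertices are listed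
  separately among the cells so that the trivial group with no generators has a one-point
  realization.
\<close>

definition cayley_cells :: "('a, 'm) monoid_scheme \<Rightarrow> 'a set \<Rightarrow> 'a set set" where
  "cayley_cells G A =
     {{g} |g. g \<in> carrier G} \<union>
     {{g, g \<otimes>\<^bsub>G\<^esub> a} |g a. g \<in> carrier G \<and> a \<in> sym_gens G A}"

definition cell_points :: "'a set \<Rightarrow> ('a \<Rightarrow> real) set" where
  "cell_points e = {x. (\<forall>v. x v \<ge> 0) \<and> (\<forall>v. v \<notin> e \<longrightarrow> x v = 0) \<and> (\<Sum>v\<in>e. x v) = 1}"

definition cayley_realization :: "('a, 'm) monoid_scheme \<Rightarrow> 'a set \<Rightarrow> ('a \<Rightarrow> real) set" where
  "cayley_realization G A = (\<Union>e\<in>cayley_cells G A. cell_points e)"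

text \<open>
  The metric is the path metric in which every edge is isometric to the unit interval. A broken
  path is a chain of points such that consecutive points lie in a common closed cell. On the
  edge \<open>{u, v}\<close> the distance between \<open>x\<close> and \<open>y\<close> is \<open>\<bar>x u - y u\<bar> = \<bar>x v - y v\<bar>\<close>, which is half
  the sum of the two.
\<close>

definition cayley_chain ::
  "('a, 'm) monoid_scheme \<Rightarrow> 'a set \<Rightarrow> nat \<Rightarrow> (nat \<Rightarrow> 'a \<Rightarrow> real) \<Rightarrow> bool" where
  "cayley_chain G A n c \<longleftrightarrow>
     (\<forall>i<n. \<exists>e\<in>cayley_cells G A. c i \<in> cell_points e \<and> c (Suc i) \<in> cell_points e)"

definition cell_dist :: "('a \<Rightarrow> real) \<Rightarrow> ('a \<Rightarrow> real) \<Rightarrow> real" where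
  "cell_dist x y = (\<Sum>v | x v \<noteq> 0 \<or> y v \<noteq> 0. \<bar>x v - y v\<bar>) / 2"

definition realization_dist ::
  "('a, 'm) monoid_scheme \<Rightarrow> 'a set \<Rightarrow> ('a \<Rightarrow> real) \<Rightarrow> ('a \<Rightarrow> real) \<Rightarrow> real" where
  "realization_dist G A x y =
     Inf {(\<Sum>i<n. cell_dist (c i) (c (Suc i))) |n c. cayley_chain G A n c \<and> c 0 = x \<and> c n = y}"

section \<open>Hyperbolicity\<close>

definition geodesic_segment ::
  "'x set \<Rightarrow> ('x \<Rightarrow> 'x \<Rightarrow> real) \<Rightarrow> 'x \<Rightarrow> 'x \<Rightarrow> 'x set \<Rightarrow> bool" where
  "geodesic_segment X d x y S \<longleftrightarrow>
     (\<exists>\<sigma>. \<sigma> 0 = x \<and> \<sigma> (d x y) = y \<and> \<sigma> ` {0..d x y} = S \<and> S \<subseteq> X \<and>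
          (\<forall>s\<in>{0..d x y}. \<forall>t\<in>{0..d x y}. d (\<sigma> s) (\<sigma> t) = \<bar>s - t\<bar>))"

text \<open>
  Neighbourhoods are only taken of unions of two geodesic segments. These are compact, so the
  distance to such a set is attained.
\<close>

definition closed_nbhd :: "'x set \<Rightarrow> ('x \<Rightarrow> 'x \<Rightarrow> real) \<Rightarrow> real \<Rightarrow> 'x set \<Rightarrow> 'x set" where
  "closed_nbhd X d \<delta> S = {p\<in>X. \<exists>q\<in>S. d p q \<le> \<delta>}"

definition delta_hyperbolic :: "'x set \<Rightarrow> ('x \<Rightarrow> 'x \<Rightarrow> real) \<Rightarrow> real \<Rightarrow> bool" where
  "delta_hyperbolic X d \<delta> \<longleftrightarrow>
     (\<forall>x\<in>X. \<forall>y\<in>X. \<forall>z\<in>X. \<forall>S1 S2 S3.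
        geodesic_segment X d x y S1 \<and> geodesic_segment X d y z S2 \<and> geodesic_segment X d z x S3 \<longrightarrow>
        S1 \<subseteq> closed_nbhd X d \<delta> (S2 \<union> S3) \<and>
        S2 \<subseteq> closed_nbhd X d \<delta> (S1 \<union> S3) \<and>
        S3 \<subseteq> closed_nbhd X d \<delta> (S1 \<union> S2))"

text \<open>
  Hyperbolicity does not depend on the finite generating set, so it is a property of the group;
  it is expressed here by the existence of a suitable one.
\<close>

definition hyperbolic_group :: "('a, 'm) monoid_scheme \<Rightarrow> bool" where
  "hyperbolic_group G \<longleftrightarrow>
     group G \<and>
     (\<exists>A. finite_generating_set G A \<and>
        (\<exists>\<delta>\<ge>0. delta_hyperbolic (cayley_realization G A) (realization_dist G A) \<delta>))"

section \<open>Gromov product and visual metrics\<close>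

definition gromov_product ::
  "('a, 'm) monoid_scheme \<Rightarrow> 'a set \<Rightarrow> 'a \<Rightarrow> 'a \<Rightarrow> 'a \<Rightarrow> real" where
  "gromov_product G A p g h =
     (word_dist G A p g + word_dist G A p h - word_dist G A g h) / 2"

definition visual_rho ::
  "('a, 'm) monoid_scheme \<Rightarrow> 'a set \<Rightarrow> 'a \<Rightarrow> real \<Rightarrow> 'a \<Rightarrow> 'a \<Rightarrow> real" where
  "visual_rho G A p \<gamma> g h = (if g \<noteq> h then exp (- \<gamma> * gromov_product G A p g h) else 0)"

definition visual_metrics ::
  "('a, 'm) monoid_scheme \<Rightarrow> 'a set \<Rightarrow> 'a \<Rightarrow> real \<Rightarrow> real \<Rightarrow> 'a metric set" where
  "visual_metrics G A p \<gamma> T =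
     {d. mspace d = carrier G \<and>
         (\<forall>g\<in>carrier G. \<forall>h\<in>carrier G. g \<noteq> h \<longrightarrow>
            1 / T * visual_rho G A p \<gamma> g h \<le> mdist d g h \<and>
            mdist d g h \<le> T * visual_rho G A p \<gamma> g h)}"

section \<open>Maps between metric spaces\<close>

definition holder_map :: "'x metric \<Rightarrow> 'y metric \<Rightarrow> ('x \<Rightarrow> 'y) \<Rightarrow> bool" where
  "holder_map m m' f \<longleftrightarrow>
     f \<in> mspace m \<rightarrow> mspace m' \<and>
     (\<exists>r>0. \<exists>K>0. \<forall>x\<in>mspace m. \<forall>y\<in>mspace m. mdist m' (f x) (f y) \<le> K * mdist m x y powr r)"

definition quasi_isometric_embedding ::
  "'x set \<Rightarrow> ('x \<Rightarrow> 'x \<Rightarrow> real) \<Rightarrow> 'y set \<Rightarrow> ('y \<Rightarrow> 'y \<Rightarrow> real) \<Rightarrow> ('x \<Rightarrow> 'y) \<Rightarrow> bool" where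
  "quasi_isometric_embedding X d X' d' f \<longleftrightarrow>
     f \<in> X \<rightarrow> X' \<and>
     (\<exists>L\<ge>1. \<exists>K\<ge>0. \<forall>x\<in>X. \<forall>y\<in>X.
        1 / L * d x y - K \<le> d' (f x) (f y) \<and> d' (f x) (f y) \<le> L * d x y + K)"

text \<open>
  The completion is determined up to isometry over the given space: it is a complete metric space
  together with an isometric embedding \<open>\<iota>\<close> with dense image. It exists by
  \<open>Metric_space.metric_completion\<close>.
\<close>

definition metric_completion_of :: "'x metric \<Rightarrow> 'y metric \<Rightarrow> ('x \<Rightarrow> 'y) \<Rightarrow> bool" where
  "metric_completion_of m m' \<iota> \<longleftrightarrow>
     mcomplete_of m' \<and>
     \<iota> \<in> mspace m \<rightarrow> mspace m' \<and>
     (\<forall>x\<in>mspace m. \<forall>y\<in>mspace m. mdist m' (\<iota> x) (\<iota> y) = mdist m x y) \<and>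
     mtopology_of m' closure_of (\<iota> ` mspace m) = mspace m'"

lemma metric_completion_exists:
  fixes m :: "'x metric"
  shows "\<exists>m' (\<iota> :: 'x \<Rightarrow> 'x \<Rightarrow> real). metric_completion_of m m' \<iota>"
proof -
  obtain \<iota> :: "'x \<Rightarrow> 'x \<Rightarrow> real" and m' where
    "mcomplete_of m'" "\<iota> \<in> mspace m \<rightarrow> mspace m'"
    "mtopology_of m' closure_of \<iota> ` mspace m = mspace m'"
    "\<And>x y. \<lbrakk>x \<in> mspace m; y \<in> mspace m\<rbrakk> \<Longrightarrow> mdist m' (\<iota> x) (\<iota> y) = mdist m x y"
    using Metric_space.metric_completion[OF Metric_space_mspace_mdist] by metis
  then show ?thesis
    unfolding metric_completion_of_def by blast
qed

definition extends_along :: "'x metric \<Rightarrow> ('x \<Rightarrow> 'y) \<Rightarrow> ('x \<Rightarrow> 'x) \<Rightarrow> ('y \<Rightarrow> 'y) \<Rightarrow> bool" where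
  "extends_along m \<iota> f F \<longleftrightarrow> (\<forall>x\<in>mspace m. F (\<iota> x) = \<iota> (f x))"

section \<open>Equivalence of a list of conditions\<close>

definition all_equivalent :: "bool list \<Rightarrow> bool" where
  "all_equivalent Ps \<longleftrightarrow> (\<forall>P\<in>set Ps. \<forall>Q\<in>set Ps. P \<longleftrightarrow> Q)"

end

(* The implication from (i) or (iii) to (vii): if the kernel is infinite, it contains a sequence k_n
   that tends to infinity and is Cauchy for d. For x outside the kernel, k_n and k_n x have the same
   limit in the completion since their word distance is bounded, but their images are constant and
   distinct. A finite kernel is trivial by torsion-freeness, so (viii) follows from the co-hopfian
   property.

   The implication from (vi) to (v): on a geodesic with nearest point c_0 to p, at distance D, the
   point c_i is at distance at least D/2 + i/4 from p. Hence the images of points of the geodesic, taken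
   with a large fixed stride, have consecutive Gromov products that grow linearly fast enough to
   absorb the error of the four-point inequality at each step, and the Gromov product of the images
   of the endpoints is bounded below by a multiple of D. The same estimate for the identity map
   compares the Gromov products of A with those of the generating set that witnesses
   hyperbolicity. *)

theory Submission
  imports Defs
begin

section \<open>Discrete geodesics and Gromov products\<close>

text \<open>Hyperbolicity comes with some generating set \<open>B\<close>, whereas the conditions
  speak of \<open>A\<close>. The four-point inequality is not carried over from \<open>B\<close> to
  \<open>A\<close>. It is needed only in the target of a map: in the source, a Gromov product is at
  most the distance from the base point to a geodesic, by the triangle inequality alone. So the step
  from (vi) to (v) regards \<phi> as a map from the word metric of \<open>A\<close> to that of
  \<open>B\<close> and returns to \<open>A\<close> by an inequality between Gromov products, whose
  multiplicative constant is absorbed into the \<open>P\<close> of (v). Bounding the Gromov products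
  of images directly replaces the stability of quasi-geodesics: no geodesic between images is
  compared with the image of a geodesic. The geometric realization serves only to pass from real
  thin triangles to integer-parametrized ones between vertices. Since visual metrics are comparable
  to exponentials of Gromov products, (v) gives (ii) by exponentiation.\<close>

definition gromov_prod :: "('a \<Rightarrow> 'a \<Rightarrow> real) \<Rightarrow> 'a \<Rightarrow> 'a \<Rightarrow> 'a \<Rightarrow> real" where
  "gromov_prod d w x y = (d w x + d w y - d x y) / 2"

text \<open>Gromov's form of hyperbolicity. It involves only distances between points of
  \<open>M\<close>, so it makes sense on the vertices of a Cayley graph, without the interiors of
  edges.\<close>

definition four_point :: "'a set \<Rightarrow> ('a \<Rightarrow> 'a \<Rightarrow> real) \<Rightarrow> real \<Rightarrow> bool" where
  "four_point M d \<delta> \<longleftrightarrow> (\<forall>w\<in>M. \<forall>x\<in>M. \<forall>y\<in>M. \<forall>z\<in>M.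
     min (gromov_prod d w x y) (gromov_prod d w y z) - \<delta> \<le> gromov_prod d w x z)"

text \<open>Integer parameters suffice because word metrics are integer-valued. The values of
  \<open>c\<close> beyond \<open>n\<close> are free.\<close>

definition discrete_geodesic ::
  "'a set \<Rightarrow> ('a \<Rightarrow> 'a \<Rightarrow> real) \<Rightarrow> 'a \<Rightarrow> 'a \<Rightarrow> nat \<Rightarrow> (nat \<Rightarrow> 'a) \<Rightarrow> bool" where
  "discrete_geodesic M d x y n c \<longleftrightarrow> c 0 = x \<and> c n = y \<and> (\<forall>i\<le>n. c i \<in> M) \<and>
     (\<forall>i\<le>n. \<forall>j\<le>n. d (c i) (c j) = \<bar>real i - real j\<bar>)"

lemma discrete_geodesicD:
  assumes "discrete_geodesic M d x y n c"
  shows "c 0 = x" "c n = y" "\<And>i. i \<le> n \<Longrightarrow> c i \<in> M"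
    "\<And>i j. i \<le> n \<Longrightarrow> j \<le> n \<Longrightarrow> d (c i) (c j) = \<bar>real i - real j\<bar>"
    "x \<in> M" "y \<in> M" "d x y = real n"
    "\<And>i. i \<le> n \<Longrightarrow> d x (c i) = real i" "\<And>i. i \<le> n \<Longrightarrow> d (c i) y = real n - real i"
proof -
  show *: "c 0 = x" "c n = y" "\<And>i. i \<le> n \<Longrightarrow> c i \<in> M"
    "\<And>i j. i \<le> n \<Longrightarrow> j \<le> n \<Longrightarrow> d (c i) (c j) = \<bar>real i - real j\<bar>"
    using assms unfolding discrete_geodesic_def by blast+
  show "x \<in> M" "y \<in> M" using *(1) *(2) *(3)[of 0] *(3)[of n] by auto
  show "d x y = real n" using *(1) *(2) *(4)[of 0 n] by simp
  show "\<And>i. i \<le> n \<Longrightarrow> d x (c i) = real i" using *(1) *(4)[of 0] by simp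
  show "\<And>i. i \<le> n \<Longrightarrow> d (c i) y = real n - real i" using *(2) *(4)[of _ n] by simp
qed

locale discrete_geodesic_space = Metric_space +
  assumes geodesic_exists: "x \<in> M \<Longrightarrow> y \<in> M \<Longrightarrow> \<exists>n c. discrete_geodesic M d x y n c"

section \<open>Gromov products, thin triangles and the four-point inequality\<close>

context Metric_space
begin

lemma gromov_prod_commute: "gromov_prod d w x y = gromov_prod d w y x"
  using commute[of x y] unfolding gromov_prod_def by simp

lemma gromov_prod_basepoint:
  assumes "w \<in> M" "w' \<in> M" "x \<in> M" "y \<in> M"
  shows "gromov_prod d w x y \<le> gromov_prod d w' x y + d w w'"
  using triangle[of w w' x] triangle[of w w' y] assms unfolding gromov_prod_def
  by (simp add: field_simps)

lemma gromov_prod_nonneg: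
  assumes "w \<in> M" "x \<in> M" "y \<in> M"
  shows "0 \<le> gromov_prod d w x y"
  using triangle[of x w y] commute[of x w] assms unfolding gromov_prod_def by simp

lemma gromov_prod_le:
  assumes "w \<in> M" "x \<in> M" "y \<in> M"
  shows "gromov_prod d w x y \<le> d w x"
  using triangle[of w x y] assms unfolding gromov_prod_def by simp

text \<open>Source of the lower bounds: two points that are close together but far from
  \<open>w\<close> have a large product.\<close>

lemma gromov_prod_ge:
  assumes "w \<in> M" "x \<in> M" "y \<in> M"
  shows "d w x - d x y \<le> gromov_prod d w x y"
  using triangle[of w y x] commute[of x y] assms unfolding gromov_prod_def by simp

text \<open>In the detour of both sides through \<open>c i\<close> the length of the geodesic
  cancels. This is the half of the comparison between products and distances to geodesics that holds
  in every metric space.\<close>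

lemma gromov_prod_le_dist_geodesic:
  assumes "discrete_geodesic M d x y n c" "i \<le> n" "w \<in> M"
  shows "gromov_prod d w x y \<le> d w (c i)"
proof -
  note c = discrete_geodesicD[OF assms(1)]
  have "d w x \<le> d w (c i) + d x (c i)" "d w y \<le> d w (c i) + d (c i) y"
    using triangle[of w "c i" x] triangle[of w "c i" y] commute[of "c i" x] c assms by auto
  then show ?thesis
    using c(7) c(8)[OF assms(2)] c(9)[OF assms(2)] unfolding gromov_prod_def by simp
qed

text \<open>Along the side from \<open>x\<close> to \<open>z\<close>, nearness to the side at
  \<open>x\<close> must give way to nearness to the side at \<open>z\<close>. At the switch a point
  is close to both, up to one discrete step, which accounts for the \<open>+ 1\<close>.\<close>

lemma dist_geodesic_le_gromov_prod_if_thin: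
  assumes c1: "discrete_geodesic M d x z n1 c1"
    and c2: "discrete_geodesic M d z w n2 c2" and c3: "discrete_geodesic M d w x n3 c3"
    and "\<delta> \<ge> 0"
    and thin: "\<And>i. i \<le> n1 \<Longrightarrow> (\<exists>j\<le>n2. d (c1 i) (c2 j) \<le> \<delta>) \<or> (\<exists>j\<le>n3. d (c1 i) (c3 j) \<le> \<delta>)"
  shows "\<exists>i\<le>n1. d w (c1 i) \<le> gromov_prod d w x z + 2 * \<delta> + 1"
proof -
  note c1 = discrete_geodesicD[OF c1] note c2 = discrete_geodesicD[OF c2]
  note c3 = discrete_geodesicD[OF c3]
  have "\<exists>i j k. i \<le> n1 \<and> j \<le> n2 \<and> k \<le> n3 \<and> d (c1 i) (c3 k) \<le> \<delta> \<and> d (c1 i) (c2 j) \<le> \<delta> + 1"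
  proof (cases "\<exists>k\<le>n3. d (c1 n1) (c3 k) \<le> \<delta>")
    case True
    \<comment> \<open>Without a switch the corner \<open>z\<close>, where \<open>c2\<close> starts,
      serves as the point close to both sides.\<close>
    moreover have "d (c1 n1) (c2 0) = 0" using c1 c2 by simp
    ultimately show ?thesis using \<open>\<delta> \<ge> 0\<close> by (metis add_increasing le0 order_refl zero_le_one)
  next
    case False
    define P where "P i = (\<exists>k\<le>n3. d (c1 i) (c3 k) \<le> \<delta>)" for i
    have "P 0" unfolding P_def using c1 c3 \<open>\<delta> \<ge> 0\<close> by (intro exI[of _ n3]) simp
    moreover have "\<not> P n1" using False P_def by simp
    ultimately obtain i where i: "i < n1" "P i" "\<not> P (Suc i)"
      using dec_induct[of 0 n1 P] by (metis le0)
    then obtain j where j: "j \<le> n2" "d (c1 (Suc i)) (c2 j) \<le> \<delta>"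
      using thin[of "Suc i"] P_def by auto
    have "d (c1 i) (c1 (Suc i)) = 1" using c1(4)[of i "Suc i"] i by simp
    then have "d (c1 i) (c2 j) \<le> \<delta> + 1"
      using triangle[of "c1 i" "c1 (Suc i)" "c2 j"] c1(3) c2(3) i j by fastforce
    then show ?thesis using i j P_def by (meson less_imp_le)
  qed
  then obtain i j k where i: "i \<le> n1" and j: "j \<le> n2" and k: "k \<le> n3"
    and "d (c1 i) (c3 k) \<le> \<delta>" "d (c1 i) (c2 j) \<le> \<delta> + 1" by blast
  note d = this(4,5)
  have M: "c1 i \<in> M" "c2 j \<in> M" "c3 k \<in> M" using c1 c2 c3 i j k by auto
  have "d w (c1 i) \<le> real k + d (c1 i) (c3 k)"
    using triangle[of w "c3 k" "c1 i"] c3 k M commute[of "c1 i" "c3 k"] by simp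
  moreover have "real i \<le> d (c1 i) (c3 k) + (real n3 - real k)"
    using triangle[of "c1 i" "c3 k" x] c1 c3 i k M commute[of "c1 i" x] by simp
  moreover have "d w (c1 i) \<le> (real n2 - real j) + d (c1 i) (c2 j)"
    using triangle[of w "c2 j" "c1 i"] c2 j M commute[of "c1 i" "c2 j"] commute[of w "c2 j"]
    by simp
  moreover have "real n1 - real i \<le> d (c1 i) (c2 j) + real j"
    using triangle[of "c1 i" "c2 j" z] c1 c2 i j M commute[of "c2 j" z] by simp
  moreover have "gromov_prod d w x z = (real n3 + real n2 - real n1) / 2"
    unfolding gromov_prod_def using c1(7) c2(7) c3(7) commute[of w z] by simp
  \<comment> \<open>Half the sum of the four inequalities; \<open>i\<close>, \<open>j\<close> and
    \<open>k\<close> cancel.\<close>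
  ultimately have "d w (c1 i) \<le> gromov_prod d w x z + 2 * \<delta> + 1" using d by argo
  then show ?thesis using i by blast
qed

end

text \<open>A point of the side \<open>x z\<close> at distance about (x|z) from \<open>w\<close> is
  \<delta>-near the side \<open>x y\<close> or \<open>y z\<close>, so one of (x|y), (y|z) exceeds
  that distance by at most \<delta>. The constant is 2\<delta> + 1 for the choice of the point plus
  this \<delta>.\<close>

lemma (in discrete_geodesic_space) four_point_if_thin:
  assumes "\<delta> \<ge> 0"
    and thin: "\<And>x y z n1 c1 n2 c2 n3 c3 i. discrete_geodesic M d x y n1 c1 \<Longrightarrow>
      discrete_geodesic M d y z n2 c2 \<Longrightarrow> discrete_geodesic M d z x n3 c3 \<Longrightarrow> i \<le> n1 \<Longrightarrow>
      (\<exists>j\<le>n2. d (c1 i) (c2 j) \<le> \<delta>) \<or> (\<exists>j\<le>n3. d (c1 i) (c3 j) \<le> \<delta>)"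
  shows "four_point M d (3 * \<delta> + 1)"
  unfolding four_point_def
proof (intro ballI)
  fix w x y z assume M: "w \<in> M" "x \<in> M" "y \<in> M" "z \<in> M"
  obtain n1 c1 n2 c2 n3 c3 n4 c4 n5 c5 where c: "discrete_geodesic M d x z n1 c1"
    "discrete_geodesic M d z w n2 c2" "discrete_geodesic M d w x n3 c3"
    "discrete_geodesic M d z y n4 c4" "discrete_geodesic M d y x n5 c5"
    using geodesic_exists M by metis
  obtain i where i: "i \<le> n1" "d w (c1 i) \<le> gromov_prod d w x z + 2 * \<delta> + 1"
    using dist_geodesic_le_gromov_prod_if_thin[OF c(1-3) \<open>\<delta> \<ge> 0\<close> thin[OF c(1-3)]] by blast
  have near: "gromov_prod d w u v \<le> d w (c1 i) + \<delta>"
    if g: "discrete_geodesic M d u v n c'" "j \<le> n" "d (c1 i) (c' j) \<le> \<delta>" for u v n c' j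
    using gromov_prod_le_dist_geodesic[OF g(1,2) M(1)] triangle[of w "c1 i" "c' j"] M(1)
      discrete_geodesicD(3)[OF c(1) i(1)] discrete_geodesicD(3)[OF g(1,2)] g(3) by linarith
  have "gromov_prod d w x y \<le> d w (c1 i) + \<delta> \<or> gromov_prod d w y z \<le> d w (c1 i) + \<delta>"
    using thin[OF c(1,4,5) i(1)] near[OF c(4)] near[OF c(5)]
      gromov_prod_commute[of w x y] gromov_prod_commute[of w y z] by auto
  then show "min (gromov_prod d w x y) (gromov_prod d w y z) - (3 * \<delta> + 1) \<le> gromov_prod d w x z"
    using i(2) by linarith
qed

text \<open>Backward induction in jumps of \<open>N\<close>. Over one jump the lower bound
  \<open>far\<close> grows by \<delta>, exactly what one use of the four-point inequality costs, so
  errors do not accumulate; only the final \<delta> and the step bound \<open>S\<close>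
  remain.\<close>

lemma gromov_prod_chain:
  assumes four: "four_point M d \<delta>"
    and "Metric_space M d" and w: "w \<in> M" and u: "\<And>i. i \<le> n \<Longrightarrow> u i \<in> M"
    and step: "\<And>i j. i \<le> j \<Longrightarrow> j \<le> n \<Longrightarrow> j \<le> i + N \<Longrightarrow> d (u i) (u j) \<le> S"
    and far: "\<And>i. i \<le> n \<Longrightarrow> \<alpha> + \<delta> / real N * real i \<le> d w (u i)"
    and "N > 0" "\<delta> \<ge> 0" "j \<le> n"
  shows "\<alpha> - S - \<delta> + \<delta> / real N * real j \<le> gromov_prod d w (u j) (u n)"
  using \<open>j \<le> n\<close>
proof (induction "n - j" arbitrary: j rule: less_induct)
  case less
  interpret Metric_space M d by fact
  have close: "\<alpha> - S + \<delta> / real N * real j \<le> gromov_prod d w (u j) (u k)"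
    if "j \<le> k" "k \<le> n" "k \<le> j + N" for k
    using gromov_prod_ge[OF w u u, of j k] step[of j k] far[of j] that less.prems by force
  show ?case
  proof (cases "n \<le> j + N")
    case True
    then show ?thesis using close[of n] less.prems \<open>\<delta> \<ge> 0\<close> by simp
  next
    case False
    let ?k = "j + N"
    have "\<alpha> - S - \<delta> + \<delta> / real N * real ?k \<le> gromov_prod d w (u ?k) (u n)"
      using less.hyps[of ?k] False \<open>N > 0\<close> by force
    moreover have "\<delta> / real N * real ?k = \<delta> / real N * real j + \<delta>"
      using \<open>N > 0\<close> by (simp add: field_simps)
    moreover have "min (gromov_prod d w (u j) (u ?k)) (gromov_prod d w (u ?k) (u n)) - \<delta>
        \<le> gromov_prod d w (u j) (u n)"
      using four w u less.prems False unfolding four_point_def by force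
    ultimately show ?thesis using close[of ?k] False by linarith
  qed
qed

section \<open>Quasi-isometric embeddings into spaces with the four-point inequality\<close>

locale quasi_isometry = X: Metric_space M d + Y: Metric_space M' d'
  for M :: "'a set" and d and M' :: "'b set" and d' +
  fixes f :: "'a \<Rightarrow> 'b" and L K :: real
  assumes maps_to: "x \<in> M \<Longrightarrow> f x \<in> M'"
    and L_ge_1: "L \<ge> 1" and K_nonneg: "K \<ge> 0"
    and lower: "x \<in> M \<Longrightarrow> y \<in> M \<Longrightarrow> d x y / L - K \<le> d' (f x) (f y)"
    and upper: "x \<in> M \<Longrightarrow> y \<in> M \<Longrightarrow> d' (f x) (f y) \<le> L * d x y + K"
begin

text \<open>The starting point of \<open>c\<close> is a nearest point to \<open>b\<close> on \<open>c\<close>, so \<open>c i\<close> is at distance at least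
  \<open>max D (i - D) \<ge> D / 2 + i / 4\<close> from \<open>b\<close>.\<close>

lemma gromov_prod_ge_geodesic_ray:
  assumes four: "four_point M' d' \<delta>" "\<delta> \<ge> 0"
    and N: "N > 0" "4 * L * \<delta> \<le> real N"
    and c: "\<And>i. i \<le> n \<Longrightarrow> c i \<in> M"
      "\<And>i j. i \<le> n \<Longrightarrow> j \<le> n \<Longrightarrow> d (c i) (c j) = \<bar>real i - real j\<bar>"
    and b: "b \<in> M" and nearest: "\<And>i. i \<le> n \<Longrightarrow> d b (c 0) \<le> d b (c i)"
  shows "d b (c 0) / (2 * L) - (2 * K + L * real N + \<delta>) \<le> gromov_prod d' (f b) (f (c 0)) (f (c n))"
proof -
  \<comment> \<open>The images satisfy \<open>d' (f b) (f (c i))\<close> \<ge> (D/2 + i/4)/L - K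
    with \<open>D = d b (c 0)\<close>. The constant part is \<alpha>, and the slope 1/(4L) is at
    least \<delta>/N by the choice of \<open>N\<close>.\<close>
  define \<alpha> where "\<alpha> = d b (c 0) / (2 * L) - K"
  have "\<alpha> - (L * real N + K) - \<delta> + \<delta> / real N * real 0
      \<le> gromov_prod d' (f b) (f (c 0)) (f (c n))"
  proof (rule gromov_prod_chain[OF four(1) Y.Metric_space_axioms, where u = "\<lambda>i. f (c i)"])
    show "d' (f (c i)) (f (c j)) \<le> L * real N + K" if "i \<le> j" "j \<le> n" "j \<le> i + N" for i j
    proof -
      have "L * d (c i) (c j) \<le> L * real N"
        using c(2)[of i j] that L_ge_1 by (intro mult_left_mono) auto
      then show ?thesis using upper[OF c(1) c(1), of i j] that by linarith
    qed
    show "\<alpha> + \<delta> / real N * real i \<le> d' (f b) (f (c i))" if "i \<le> n" for i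
    proof -
      have "d b (c i) \<ge> real i - d b (c 0)"
        using X.triangle[of "c 0" b "c i"] c(1)[of 0] c(1)[of i] c(2)[of 0 i] b that
          X.commute[of b "c 0"] by simp
      \<comment> \<open>Convex combination of the bounds D and i - D with weights 3/4 and
        1/4.\<close>
      with nearest[OF that] have "d b (c 0) / 2 + real i / 4 \<le> d b (c i)" by linarith
      then have "(d b (c 0) / 2 + real i / 4) / L \<le> d b (c i) / L"
        using L_ge_1 by (intro divide_right_mono) auto
      moreover have "(d b (c 0) / 2 + real i / 4) / L = d b (c 0) / (2 * L) + 1 / (4 * L) * real i"
        using L_ge_1 by (simp add: field_simps)
      moreover have "\<delta> / real N * real i \<le> 1 / (4 * L) * real i"
        using N L_ge_1 by (intro mult_right_mono) (auto simp: field_simps)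
      ultimately show ?thesis
        using lower[OF b c(1)[OF that]] unfolding \<alpha>_def by linarith
    qed
  qed (use maps_to b c N four in auto)
  then show ?thesis unfolding \<alpha>_def by (simp add: algebra_simps)
qed

text \<open>Splitting the geodesic at a point nearest to \<open>b\<close> gives two rays to which
  the previous bound applies, and one more four-point inequality at the splitting point joins them.
  The constants do not depend on the length of the geodesic.\<close>

proposition geodesic_near_if_gromov_prod_small:
  assumes four: "four_point M' d' \<delta>" "\<delta> \<ge> 0"
  shows "\<exists>P>0. \<exists>Q. \<forall>x y n c b. discrete_geodesic M d x y n c \<longrightarrow> b \<in> M \<longrightarrow>
           (\<exists>i\<le>n. d b (c i) \<le> P * gromov_prod d' (f b) (f x) (f y) + Q)"
proof -
  obtain N0 :: nat where "4 * L * \<delta> \<le> real N0" using real_arch_simple by blast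
  \<comment> \<open>The successor keeps the stride positive even if \<delta> = 0.\<close>
  then obtain N :: nat where N: "N > 0" "4 * L * \<delta> \<le> real N"
    by (intro that[of "Suc N0"]) auto
  define C where "C = 2 * K + L * real N + \<delta>"
  have "\<exists>i\<le>n. d b (c i) \<le> (2 * L) * gromov_prod d' (f b) (f x) (f y) + 2 * L * (C + \<delta>)"
    if "discrete_geodesic M d x y n c" and b: "b \<in> M" for x y n c b
  proof -
    note c = discrete_geodesicD[OF that(1)]
    obtain m where m: "m \<le> n" "\<And>i. i \<le> n \<Longrightarrow> d b (c m) \<le> d b (c i)"
      using ex_min_if_finite[of "(\<lambda>i. d b (c i)) ` {..n}"] by (auto simp: not_less)
    let ?D = "d b (c m)"
    let ?g = "gromov_prod d' (f b)"
    have right: "?D / (2 * L) - C \<le> ?g (f (c m)) (f y)"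
      using gromov_prod_ge_geodesic_ray[OF four N _ _ b, of "n - m" "\<lambda>i. c (m + i)"] c m
      unfolding C_def by (simp add: le_diff_conv2 add.commute)
    \<comment> \<open>The first half is run backwards so that it too starts at the nearest
      point.\<close>
    have left: "?D / (2 * L) - C \<le> ?g (f (c m)) (f x)"
      using gromov_prod_ge_geodesic_ray[OF four N _ _ b, of m "\<lambda>i. c (m - i)"] c m
      unfolding C_def by simp
    have "min (?g (f x) (f (c m))) (?g (f (c m)) (f y)) - \<delta> \<le> ?g (f x) (f y)"
      using four(1) maps_to b c m(1) unfolding four_point_def by simp
    with left right have "?D / (2 * L) - C - \<delta> \<le> ?g (f x) (f y)"
      using Y.gromov_prod_commute[of "f b" "f x" "f (c m)"] by linarith
    then have "(2 * L) * (?D / (2 * L)) \<le> (2 * L) * (?g (f x) (f y) + (C + \<delta>))"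
      using L_ge_1 by (intro mult_left_mono) auto
    then have "?D \<le> (2 * L) * ?g (f x) (f y) + 2 * L * (C + \<delta>)"
      using L_ge_1 by (simp add: distrib_left)
    then show ?thesis using m(1) by blast
  qed
  then show ?thesis using L_ge_1 by (intro exI[of _ "2 * L"]) (auto intro!: exI[of _ "2 * L * (C + \<delta>)"])
qed

end

text \<open>\<open>c k\<close> is an approximate centre of the triangle \<open>w, x, y\<close>. The
  four-point inequality makes (c k|y) at \<open>w\<close> almost \<open>k\<close>, and (c k|y) at
  \<open>w\<close> plus (w|y) at \<open>c k\<close> equals \<open>d w (c k) = k\<close>; hence
  \<open>c k\<close> almost lies between \<open>w\<close> and \<open>y\<close> as well.\<close>

lemma geodesic_point_at_gromov_prod:
  assumes "Metric_space M d" and four: "four_point M d \<delta>"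
    and c: "discrete_geodesic M d w x n c" and y: "y \<in> M"
    and k: "real k \<le> gromov_prod d w x y" "gromov_prod d w x y \<le> real k + 1"
  shows "k \<le> n" "gromov_prod d (c k) w y \<le> \<delta> + 1"
proof -
  interpret Metric_space M d by fact
  note c = discrete_geodesicD[OF c]
  show kn: "k \<le> n" using gromov_prod_le[of w x y] c y k by simp
  have ck: "c k \<in> M" using c kn by simp
  have "gromov_prod d w x (c k) = real k"
    unfolding gromov_prod_def using c(7) c(8)[OF kn] c(9)[OF kn] commute[of x "c k"] by simp
  moreover have "min (gromov_prod d w (c k) x) (gromov_prod d w x y) - \<delta> \<le> gromov_prod d w (c k) y"
    using four ck c y unfolding four_point_def by blast
  ultimately have "real k - \<delta> \<le> gromov_prod d w (c k) y"
    using gromov_prod_commute[of w x "c k"] k by linarith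
  moreover have "gromov_prod d (c k) w y = real k - gromov_prod d w (c k) y"
    unfolding gromov_prod_def using c(8)[OF kn] commute[of w "c k"] by (simp add: field_simps)
  ultimately show "gromov_prod d (c k) w y \<le> \<delta> + 1" by linarith
qed

text \<open>The centre of the triangle \<open>w, x, y\<close> for \<open>d'\<close> lies near the \<open>d\<close>-geodesics from \<open>w\<close> to
  \<open>x\<close> and to \<open>y\<close>.\<close>

lemma gromov_prod_le_if_four_point:
  assumes "quasi_isometry M d M d' (\<lambda>x. x) L K" "discrete_geodesic_space M d"
    "discrete_geodesic_space M d'" and four: "four_point M d' \<delta>" "\<delta> \<ge> 0"
  shows "\<exists>P>0. \<exists>Q. \<forall>w\<in>M. \<forall>x\<in>M. \<forall>y\<in>M. gromov_prod d' w x y \<le> P * gromov_prod d w x y + Q"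
proof -
  interpret quasi_isometry M d M d' "\<lambda>x. x" L K by fact
  interpret X: discrete_geodesic_space M d by fact
  interpret Y: discrete_geodesic_space M d' by fact
  obtain P Q where P: "P > 0" and near: "\<And>x y n c b. discrete_geodesic M d x y n c \<Longrightarrow> b \<in> M \<Longrightarrow>
     \<exists>i\<le>n. d b (c i) \<le> P * gromov_prod d' b x y + Q"
    using geodesic_near_if_gromov_prod_small[OF four] by blast
  \<comment> \<open>Bounds the \<open>d\<close>-distance from a point to a \<open>d\<close>-geodesic
    when the \<open>d'\<close>-product of the endpoints at that point is at most \<delta> +
    1.\<close>
  define R where "R = P * (\<delta> + 1) + Q"
  have "gromov_prod d' w x y \<le> L * gromov_prod d w x y + (2 * L * R + K + 1)"
    if M: "w \<in> M" "x \<in> M" "y \<in> M" for w x y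
  proof -
    obtain n c where c: "discrete_geodesic M d' w x n c"
      using Y.geodesic_exists M by blast
    \<comment> \<open>Rounded down to an admissible parameter of \<open>c\<close>; the lost fraction
      is the \<open>+ 1\<close> in the final constant.\<close>
    define k where "k = nat \<lfloor>gromov_prod d' w x y\<rfloor>"
    have k: "real k \<le> gromov_prod d' w x y" "gromov_prod d' w x y \<le> real k + 1"
      unfolding k_def using Y.gromov_prod_nonneg[OF M] by linarith+
    note on_c = geodesic_point_at_gromov_prod[OF Y.Metric_space_axioms four(1) c M(3) k]
    define m where "m = c k"
    have m: "m \<in> M" "d' w m = real k"
      using discrete_geodesicD[OF c] on_c(1) unfolding m_def by auto
    \<comment> \<open>Since \<open>m\<close> is within \<open>R\<close> of a
      \<open>d\<close>-geodesic from \<open>w\<close> to \<open>z\<close>, the detour through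
      \<open>m\<close> costs at most 2R. Added up for \<open>x\<close> and \<open>y\<close>, this
      bounds \<open>d w m\<close> by (x|y) + 2R.\<close>
    have ex: "d w m + d m z \<le> d w z + 2 * R"
      if z: "z \<in> M" and small: "gromov_prod d' m w z \<le> \<delta> + 1" for z
    proof -
      obtain n' c' where c': "discrete_geodesic M d w z n' c'"
        using X.geodesic_exists M z by blast
      obtain i where i: "i \<le> n'" "d m (c' i) \<le> P * gromov_prod d' m w z + Q"
        using near[OF c' m(1)] by blast
      moreover have "P * gromov_prod d' m w z \<le> P * (\<delta> + 1)"
        using small P by (intro mult_left_mono) auto
      ultimately have "d m (c' i) \<le> R" unfolding R_def by linarith
      moreover note D = discrete_geodesicD[OF c']
      have "d w m \<le> d w (c' i) + d m (c' i)" "d m z \<le> d m (c' i) + d (c' i) z"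
        using X.triangle[of w "c' i" m] X.triangle[of m "c' i" z] X.commute[of m "c' i"] M m z
          D(3)[OF i(1)] by auto
      ultimately show ?thesis using D(7) D(8)[OF i(1)] D(9)[OF i(1)] by linarith
    qed
    have "gromov_prod d' m w x = 0"
      using discrete_geodesicD[OF c] on_c(1) Y.commute[of w m] unfolding gromov_prod_def m_def by simp
    then have "d w m + d m x \<le> d w x + 2 * R" using ex[OF M(2)] four(2) by simp
    moreover have "d w m + d m y \<le> d w y + 2 * R"
      using ex[OF M(3)] on_c(2) m_def by simp
    moreover have "d x y \<le> d m x + d m y" using X.triangle[of x m y] X.commute[of x m] M m by simp
    ultimately have "d w m \<le> gromov_prod d w x y + 2 * R" unfolding gromov_prod_def by argo
    then have "L * d w m \<le> L * (gromov_prod d w x y + 2 * R)"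
      using L_ge_1 by (intro mult_left_mono) auto
    then show ?thesis using upper[of w m] M m k by (simp add: distrib_left)
  qed
  then show ?thesis using L_ge_1 by (intro exI[of _ L]) auto
qed

section \<open>The word metric\<close>

locale fg_group = group G for G (structure) +
  fixes A
  assumes finite_generating: "finite_generating_set G A"
begin

abbreviation wd where "wd \<equiv> word_dist G A"

text \<open>Makes path lengths accessible to induction over the last edge, which the
  \<open>LEAST\<close> in \<open>word_dist\<close> hides.\<close>

definition reach :: "nat \<Rightarrow> 'a \<Rightarrow> 'a \<Rightarrow> bool" where
  "reach n g h \<longleftrightarrow> (\<exists>c. cayley_path G A n c \<and> c 0 = g \<and> c n = h)"

lemma word_dist_eq: "wd g h = real (LEAST n. reach n g h)"
  unfolding word_dist_def reach_def ..

lemma sym_gens_closed: "a \<in> sym_gens G A \<Longrightarrow> a \<in> carrier G"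
  using finite_generating unfolding finite_generating_set_def sym_gens_def by auto

lemma finite_sym_gens: "finite (sym_gens G A)"
  using finite_generating unfolding finite_generating_set_def sym_gens_def by auto

lemma inv_sym_gens: "a \<in> sym_gens G A \<Longrightarrow> inv a \<in> sym_gens G A"
  using finite_generating unfolding finite_generating_set_def sym_gens_def by auto

lemma reach_carrier: "reach n g h \<Longrightarrow> g \<in> carrier G \<and> h \<in> carrier G"
  unfolding reach_def cayley_path_def by auto

lemma reach_0: "reach 0 g h \<longleftrightarrow> g \<in> carrier G \<and> h = g"
  unfolding reach_def cayley_path_def by auto

lemma reach_Suc:
  "reach (Suc n) g h \<longleftrightarrow> (\<exists>k a. reach n g k \<and> a \<in> sym_gens G A \<and> h = k \<otimes> a)"
proof
  assume "reach (Suc n) g h"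
  then obtain c where "cayley_path G A (Suc n) c" "c 0 = g" "c (Suc n) = h"
    unfolding reach_def by blast
  then show "\<exists>k a. reach n g k \<and> a \<in> sym_gens G A \<and> h = k \<otimes> a"
    unfolding reach_def cayley_path_def by (metis le_Suc_eq less_Suc_eq)
next
  assume "\<exists>k a. reach n g k \<and> a \<in> sym_gens G A \<and> h = k \<otimes> a"
  then obtain k a c where a: "a \<in> sym_gens G A" "h = k \<otimes> a" and
    c: "cayley_path G A n c" "c 0 = g" "c n = k" unfolding reach_def by blast
  then have "cayley_path G A (Suc n) (c(Suc n := h))"
    unfolding cayley_path_def by (auto simp: less_Suc_eq le_Suc_eq sym_gens_closed)
  then show "reach (Suc n) g h" unfolding reach_def using c(2) by fastforce
qed

lemma reach_trans: "reach n g h \<Longrightarrow> reach m h k \<Longrightarrow> reach (n + m) g k"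
  by (induction m arbitrary: k) (auto simp: reach_0 reach_Suc)

lemma reach_sym: "reach n g h \<Longrightarrow> reach n h g"
proof (induction n arbitrary: h)
  case (Suc n)
  then obtain k a where k: "reach n k g" "a \<in> sym_gens G A" "h = k \<otimes> a"
    unfolding reach_Suc by blast
  then have "reach 1 h k"
    using reach_carrier[OF k(1)] sym_gens_closed inv_sym_gens
    by (auto simp: reach_Suc reach_0 m_assoc intro!: exI[of _ "inv a"])
  then show ?case using reach_trans[OF _ k(1)] by fastforce
qed (auto simp: reach_0)

lemma reach_translate: "x \<in> carrier G \<Longrightarrow> reach n g h \<Longrightarrow> reach n (x \<otimes> g) (x \<otimes> h)"
proof (induction n arbitrary: h)
  case (Suc n)
  then obtain k a where "reach n g k" "a \<in> sym_gens G A" "h = k \<otimes> a"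
    unfolding reach_Suc by blast
  then show ?case
    using Suc reach_carrier by (fastforce simp: reach_Suc m_assoc sym_gens_closed)
qed (auto simp: reach_0)

lemma reach_exists:
  assumes "g \<in> carrier G" "h \<in> carrier G" shows "\<exists>n. reach n g h"
proof -
  have from_one: "\<exists>n. reach n \<one> x" if "x \<in> generate G A" for x
    using that
  proof (induction rule: generate.induct)
    case one
    then show ?case using reach_0 by blast
  next
    case (incl h)
    then have "reach 1 \<one> h"
      using sym_gens_closed by (auto simp: reach_Suc reach_0 sym_gens_def intro!: exI[of _ h])
    then show ?case by blast
  next
    case (inv h)
    then have "inv h \<in> sym_gens G A" by (auto simp: sym_gens_def)
    then have "reach 1 \<one> (inv h)"
      using sym_gens_closed by (auto simp: reach_Suc reach_0 intro!: exI[of _ "inv h"])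
    then show ?case by blast
  next
    case (eng h1 h2)
    then obtain n m where nm: "reach n \<one> h1" "reach m \<one> h2" by blast
    then have "reach m h1 (h1 \<otimes> h2)"
      using reach_translate[of h1 m \<one> h2] reach_carrier by fastforce
    then show ?case using reach_trans nm by blast
  qed
  have "inv g \<otimes> h \<in> generate G A"
    using finite_generating assms unfolding finite_generating_set_def by simp
  then obtain n where "reach n \<one> (inv g \<otimes> h)" using from_one by blast
  then have "reach n (g \<otimes> \<one>) (g \<otimes> (inv g \<otimes> h))" by (rule reach_translate[OF assms(1)])
  moreover have "g \<otimes> (inv g \<otimes> h) = h" using assms by (simp add: m_assoc[symmetric])
  ultimately have "reach n g h" using assms by simp
  then show ?thesis by blast
qed

lemma word_dist_least:
  assumes "g \<in> carrier G" "h \<in> carrier G"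
  obtains n where "wd g h = real n" "reach n g h"
  using LeastI_ex[OF reach_exists[OF assms]] word_dist_eq by blast

lemma word_dist_le: "reach n g h \<Longrightarrow> wd g h \<le> real n"
  unfolding word_dist_eq by (simp add: Least_le)

lemma word_dist_translate:
  assumes "x \<in> carrier G" "g \<in> carrier G" "h \<in> carrier G"
  shows "wd (x \<otimes> g) (x \<otimes> h) = wd g h"
proof -
  have "reach n (x \<otimes> g) (x \<otimes> h) \<longleftrightarrow> reach n g h" for n
    using reach_translate[of x n g h] reach_translate[of "inv x" n "x \<otimes> g" "x \<otimes> h"] assms
    by (auto simp: m_assoc[symmetric])
  then show ?thesis unfolding word_dist_eq by simp
qed

sublocale Metric_space "carrier G" wd
proof
  fix g h
  show "0 \<le> wd g h" unfolding word_dist_def by simp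
  have "reach n g h \<longleftrightarrow> reach n h g" for n using reach_sym by blast
  then show "wd g h = wd h g" unfolding word_dist_eq by simp
next
  fix g h assume gh: "g \<in> carrier G" "h \<in> carrier G"
  show "wd g h = 0 \<longleftrightarrow> g = h"
  proof
    assume "wd g h = 0"
    then show "g = h" using word_dist_least[OF gh] reach_0 by (metis of_nat_eq_0_iff)
  next
    assume "g = h"
    then have "wd g h \<le> real 0" using word_dist_le reach_0 gh by blast
    then show "wd g h = 0" unfolding word_dist_def by simp
  qed
next
  fix g h k assume c: "g \<in> carrier G" "h \<in> carrier G" "k \<in> carrier G"
  obtain n where n: "wd g h = real n" "reach n g h" by (rule word_dist_least[OF c(1,2)])
  obtain m where m: "wd h k = real m" "reach m h k" by (rule word_dist_least[OF c(2,3)])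
  show "wd g k \<le> wd g h + wd h k"
    using word_dist_le[OF reach_trans[OF n(2) m(2)]] n m by simp
qed

lemma reach_cayley_path:
  assumes "cayley_path G A n c" "i \<le> j" "j \<le> n"
  shows "reach (j - i) (c i) (c j)"
  using assms(2,3)
proof (induction "j - i" arbitrary: j)
  case 0
  then show ?case using assms(1) unfolding cayley_path_def by (auto simp: reach_0)
next
  case (Suc l)
  then obtain j' where j: "j = Suc j'" by (cases j) auto
  with Suc have j': "l = j' - i" "i \<le> j'" by auto
  then have "reach (j' - i) (c i) (c j')" using Suc by simp
  moreover obtain a where "a \<in> sym_gens G A" "c j = c j' \<otimes> a"
    using assms(1) Suc.prems j unfolding cayley_path_def by (metis Suc_le_eq)
  ultimately show ?case using j j' by (auto simp: Suc_diff_le reach_Suc)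
qed

text \<open>Subpaths of a shortest path are shortest: a closer pair \<open>c i\<close>,
  \<open>c j\<close> would bring the endpoints closer by the triangle inequality.\<close>

lemma cayley_path_if_word_dist:
  assumes "g \<in> carrier G" "h \<in> carrier G"
  obtains n c where "cayley_path G A n c" "discrete_geodesic (carrier G) wd g h n c"
proof -
  obtain n where n: "wd g h = real n" "reach n g h" using word_dist_least[OF assms] .
  then obtain c where c: "cayley_path G A n c" "c 0 = g" "c n = h" unfolding reach_def by blast
  have M: "c i \<in> carrier G" if "i \<le> n" for i using c(1) that unfolding cayley_path_def by blast
  have le: "wd (c i) (c j) \<le> real j - real i" if "i \<le> j" "j \<le> n" for i j
    using word_dist_le[OF reach_cayley_path[OF c(1) that]] that by (simp add: of_nat_diff)
  have "wd (c i) (c j) = real j - real i" if "i \<le> j" "j \<le> n" for i j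
    using triangle[of g "c i" h] triangle[of "c i" "c j" h] M[of i] M[of j] assms that n(1)
      le[of 0 i] le[of j n] le[OF that] c by simp
  then have "wd (c i) (c j) = \<bar>real i - real j\<bar>" if "i \<le> n" "j \<le> n" for i j
    using commute[of "c i" "c j"] that by (cases "i \<le> j") auto
  then have "discrete_geodesic (carrier G) wd g h n c"
    unfolding discrete_geodesic_def using c M by blast
  with c(1) show ?thesis by (rule that)
qed

sublocale discrete_geodesic_space "carrier G" wd
proof
  fix g h assume "g \<in> carrier G" "h \<in> carrier G"
  then show "\<exists>n c. discrete_geodesic (carrier G) wd g h n c"
    by (rule cayley_path_if_word_dist) blast
qed

lemma cayley_path_if_discrete_geodesic:
  assumes "discrete_geodesic (carrier G) wd g h n c"
  shows "cayley_path G A n c"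
  unfolding cayley_path_def
proof (intro conjI allI impI)
  note c = discrete_geodesicD[OF assms]
  show "c i \<in> carrier G" if "i \<le> n" for i using c(3) that .
  show "\<exists>a\<in>sym_gens G A. c (Suc i) = c i \<otimes> a" if "i < n" for i
  proof -
    have "wd (c i) (c (Suc i)) = real 1" using c(4)[of i "Suc i"] that by simp
    moreover have "c i \<in> carrier G" "c (Suc i) \<in> carrier G" using c(3) that by auto
    ultimately have "reach 1 (c i) (c (Suc i))"
      by (metis of_nat_eq_iff word_dist_least)
    then show ?thesis by (auto simp: reach_Suc reach_0)
  qed
qed

text \<open>Local finiteness of the Cayley graph, the source of both total boundedness of the visual
  metric and the escape of injective sequences to infinity.\<close>

lemma finite_word_ball:
  assumes "g \<in> carrier G" shows "finite {h \<in> carrier G. wd g h \<le> r}"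
proof -
  have "finite {h. reach n g h}" for n
  proof (induction n)
    case (Suc n)
    have "{h. reach (Suc n) g h} = (\<Union>k\<in>{h. reach n g h}. (\<lambda>a. k \<otimes> a) ` sym_gens G A)"
      unfolding reach_Suc by auto
    then show ?case using Suc finite_sym_gens by simp
  qed (simp add: reach_0)
  moreover have "{h \<in> carrier G. wd g h \<le> r} \<subseteq> (\<Union>n\<in>{..nat \<lfloor>r\<rfloor>}. {h. reach n g h})"
  proof
    fix h assume h: "h \<in> {h \<in> carrier G. wd g h \<le> r}"
    obtain n where n: "wd g h = real n" "reach n g h" using word_dist_least[of g h] assms h by blast
    then have "n \<le> nat \<lfloor>r\<rfloor>" using h by (simp add: le_nat_floor)
    then show "h \<in> (\<Union>n\<in>{..nat \<lfloor>r\<rfloor>}. {h. reach n g h})" using n by blast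
  qed
  ultimately show ?thesis by (meson finite_UN_I finite_atMost finite_subset)
qed

end

section \<open>The geometric realization\<close>

definition vertex_point :: "'a \<Rightarrow> 'a \<Rightarrow> real" where
  "vertex_point g = (\<lambda>u. if u = g then 1 else 0)"

definition edge_point :: "'a \<Rightarrow> 'a \<Rightarrow> real \<Rightarrow> 'a \<Rightarrow> real" where
  "edge_point g h t = (\<lambda>u. (1 - t) * vertex_point g u + t * vertex_point h u)"

text \<open>At an integer \<open>t\<close> the next vertex has weight 0. So the value at
  \<open>t = n\<close> is right although it mentions \<open>c (Suc n)\<close>, but the edge named
  there need not exist, which forces a separate case in later proofs.\<close>

definition realization_path :: "(nat \<Rightarrow> 'a) \<Rightarrow> real \<Rightarrow> 'a \<Rightarrow> real" where
  "realization_path c t =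
     edge_point (c (nat \<lfloor>t\<rfloor>)) (c (Suc (nat \<lfloor>t\<rfloor>))) (t - of_int \<lfloor>t\<rfloor>)"

lemma edge_point_0 [simp]: "edge_point g h 0 = vertex_point g"
  and edge_point_1 [simp]: "edge_point g h 1 = vertex_point h"
  unfolding edge_point_def by simp_all

lemma edge_point_cell:
  assumes "0 \<le> t" "t \<le> 1" shows "edge_point g h t \<in> cell_points {g, h}"
  using assms unfolding cell_points_def edge_point_def vertex_point_def by (cases "g = h") auto

lemma realization_path_edge:
  assumes "real i \<le> t" "t \<le> real i + 1"
  shows "realization_path c t = edge_point (c i) (c (Suc i)) (t - real i)"
proof (cases "t = real i + 1")
  case True
  then have "nat \<lfloor>t\<rfloor> = Suc i" by (simp add: nat_add_distrib)
  then show ?thesis unfolding realization_path_def using True by simp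
next
  case False
  then have "\<lfloor>t\<rfloor> = int i" using assms by linarith
  then show ?thesis unfolding realization_path_def by simp
qed

lemma realization_path_vertex: "realization_path c (real i) = vertex_point (c i)"
  using realization_path_edge[of i "real i" c] by simp

lemma cell_dist_sum:
  assumes "finite e" "x \<in> cell_points e" "y \<in> cell_points e"
  shows "cell_dist x y = (\<Sum>v\<in>e. \<bar>x v - y v\<bar>) / 2"
proof -
  have "(\<Sum>v | x v \<noteq> 0 \<or> y v \<noteq> 0. \<bar>x v - y v\<bar>) = (\<Sum>v\<in>e. \<bar>x v - y v\<bar>)"
    using assms unfolding cell_points_def by (intro sum.mono_neutral_left) auto
  then show ?thesis unfolding cell_dist_def by simp
qed

lemma cell_dist_commute: "cell_dist x y = cell_dist y x"
  unfolding cell_dist_def by (simp add: abs_minus_commute disj_commute)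

lemma cell_dist_edge_point:
  assumes "g \<noteq> h" "0 \<le> s" "s \<le> 1" "0 \<le> t" "t \<le> 1"
  shows "cell_dist (edge_point g h s) (edge_point g h t) = \<bar>s - t\<bar>"
  using assms cell_dist_sum[of "{g, h}" "edge_point g h s" "edge_point g h t"]
    edge_point_cell[of s g h] edge_point_cell[of t g h]
  unfolding edge_point_def vertex_point_def by auto

text \<open>Concatenation and reversal are statements about single lengths; working with the set
  postpones the infimum.\<close>

definition chain_lengths ::
  "('a, 'm) monoid_scheme \<Rightarrow> 'a set \<Rightarrow> ('a \<Rightarrow> real) \<Rightarrow> ('a \<Rightarrow> real) \<Rightarrow> real set" where
  "chain_lengths G A x y =
     {(\<Sum>i<n. cell_dist (c i) (c (Suc i))) |n c. cayley_chain G A n c \<and> c 0 = x \<and> c n = y}"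

lemma realization_dist_eq: "realization_dist G A x y = Inf (chain_lengths G A x y)"
  unfolding realization_dist_def chain_lengths_def ..

lemma chain_lengthsI:
  assumes "cayley_chain G A n c" "c 0 = x" "c n = y" "(\<Sum>i<n. cell_dist (c i) (c (Suc i))) = s"
  shows "s \<in> chain_lengths G A x y"
  using assms unfolding chain_lengths_def by blast

lemma chain_lengthsE:
  assumes "s \<in> chain_lengths G A x y"
  obtains n c where "cayley_chain G A n c" "c 0 = x" "c n = y"
    "s = (\<Sum>i<n. cell_dist (c i) (c (Suc i)))"
  using assms unfolding chain_lengths_def by blast

lemma chain_lengths_refl: "0 \<in> chain_lengths G A x x"
  by (rule chain_lengthsI[of _ _ 0 "\<lambda>_. x"]) (auto simp: cayley_chain_def)

lemma chain_lengths_Suc: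
  assumes "s \<in> chain_lengths G A x y" "e \<in> cayley_cells G A" "y \<in> cell_points e" "z \<in> cell_points e"
  shows "s + cell_dist y z \<in> chain_lengths G A x z"
proof -
  obtain n c where c: "cayley_chain G A n c" "c 0 = x" "c n = y"
    "s = (\<Sum>i<n. cell_dist (c i) (c (Suc i)))" using assms(1) by (rule chain_lengthsE)
  have "(\<Sum>i<n. cell_dist (if i = Suc n then z else c i) (if i = n then z else c (Suc i))) = s"
    unfolding c(4) by (intro sum.cong) auto
  then show ?thesis
    using c assms(2-) by (intro chain_lengthsI[of _ _ "Suc n" "c(Suc n := z)"])
      (auto simp: cayley_chain_def less_Suc_eq)
qed

lemma chain_lengths_induct [consumes 1, case_names refl step]:
  assumes "s \<in> chain_lengths G A x y" and "P x 0"
    and step: "\<And>s y z e. s \<in> chain_lengths G A x y \<Longrightarrow> P y s \<Longrightarrow> e \<in> cayley_cells G A \<Longrightarrow>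
      y \<in> cell_points e \<Longrightarrow> z \<in> cell_points e \<Longrightarrow> P z (s + cell_dist y z)"
  shows "P y s"
proof -
  obtain n c where c: "cayley_chain G A n c" "c 0 = x" "c n = y"
    "s = (\<Sum>i<n. cell_dist (c i) (c (Suc i)))" using assms(1) by (rule chain_lengthsE)
  have "(\<Sum>i<m. cell_dist (c i) (c (Suc i))) \<in> chain_lengths G A x (c m) \<and>
      P (c m) (\<Sum>i<m. cell_dist (c i) (c (Suc i)))" if "m \<le> n" for m
    using that
  proof (induction m)
    case 0
    then show ?case using c(2) assms(2) by (simp add: chain_lengths_refl)
  next
    case (Suc m)
    then obtain e where "e \<in> cayley_cells G A" "c m \<in> cell_points e" "c (Suc m) \<in> cell_points e"
      using c(1) unfolding cayley_chain_def by (meson Suc_le_eq)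
    moreover have IH: "(\<Sum>i<m. cell_dist (c i) (c (Suc i))) \<in> chain_lengths G A x (c m)"
      "P (c m) (\<Sum>i<m. cell_dist (c i) (c (Suc i)))" using Suc by auto
    ultimately show ?case using chain_lengths_Suc[OF IH(1)] step[OF IH] by simp
  qed
  then show ?thesis using c by blast
qed

lemma chain_lengths_cell:
  assumes "e \<in> cayley_cells G A" "x \<in> cell_points e" "y \<in> cell_points e"
  shows "cell_dist x y \<in> chain_lengths G A x y"
  using chain_lengths_Suc[OF chain_lengths_refl assms] by simp

lemma chain_lengths_trans:
  assumes "s \<in> chain_lengths G A x y" "t \<in> chain_lengths G A y z"
  shows "s + t \<in> chain_lengths G A x z"
  using assms(2)
proof (induction rule: chain_lengths_induct)
  case (step t y z e)
  then show ?case using chain_lengths_Suc[of "s + t" G A x y e z] by (simp add: add.assoc)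
qed (use assms(1) in simp)

lemma chain_lengths_sym: "s \<in> chain_lengths G A x y \<Longrightarrow> s \<in> chain_lengths G A y x"
proof (induction rule: chain_lengths_induct)
  case (step s y z e)
  then show ?case
    using chain_lengths_trans[OF chain_lengths_cell[OF step(2,4,3)] step(5)]
    by (simp add: add.commute cell_dist_commute)
qed (simp add: chain_lengths_refl)

lemma chain_lengths_nonneg: "s \<in> chain_lengths G A x y \<Longrightarrow> 0 \<le> s"
proof (induction rule: chain_lengths_induct)
  case (step s y z e)
  then show ?case unfolding cell_dist_def by (simp add: sum_nonneg)
qed simp

lemma realization_dist_le:
  assumes "s \<in> chain_lengths G A x y" shows "realization_dist G A x y \<le> s"
  unfolding realization_dist_eq
  using assms chain_lengths_nonneg by (intro cInf_lower) (auto intro!: bdd_belowI)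

section \<open>Upper and lower bounds for the metric of the realization\<close>

context fg_group
begin

text \<open>The affine extension to the realization of the distance from the vertex
  \<open>g\<close>. Being 1-Lipschitz, it bounds the infimum over chains from below.\<close>

definition linear_wd :: "'a \<Rightarrow> ('a \<Rightarrow> real) \<Rightarrow> real" where
  "linear_wd g x = (\<Sum>v | x v \<noteq> 0. x v * wd g v)"

text \<open>Vertices count as degenerate edges, so \<open>u = v\<close> is possible and all cells
  have one form.\<close>

lemma cayley_cellE:
  assumes "e \<in> cayley_cells G A"
  obtains u v where "e = {u, v}" "u \<in> carrier G" "v \<in> carrier G" "wd u v \<le> 1"
proof -
  consider u where "e = {u, u}" "u \<in> carrier G"
    | u a where "e = {u, u \<otimes> a}" "u \<in> carrier G" "a \<in> sym_gens G A"
    using assms unfolding cayley_cells_def by auto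
  then show ?thesis
  proof cases
    case 1
    then show ?thesis using that zero[of u u] by (metis zero_le_one)
  next
    case 2
    then have "reach 1 u (u \<otimes> a)" using reach_0 reach_Suc by auto
    then show ?thesis using that[of u "u \<otimes> a"] 2 word_dist_le sym_gens_closed by fastforce
  qed
qed

lemma cayley_path_cell:
  assumes "cayley_path G A n c" "i < n" shows "{c i, c (Suc i)} \<in> cayley_cells G A"
proof -
  obtain a where a: "a \<in> sym_gens G A" "c (Suc i) = c i \<otimes> a"
    using assms unfolding cayley_path_def by blast
  have "c i \<in> carrier G" using assms unfolding cayley_path_def by simp
  then have "{c i, c i \<otimes> a} \<in> {{g, g \<otimes> a} |g a. g \<in> carrier G \<and> a \<in> sym_gens G A}"
    using a(1) by blast
  then show ?thesis unfolding cayley_cells_def a(2) by (rule UnI2)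
qed

lemma linear_wd_cell:
  assumes "finite e" "x \<in> cell_points e"
  shows "linear_wd g x = (\<Sum>v\<in>e. x v * wd g v)"
  unfolding linear_wd_def
  using assms unfolding cell_points_def by (intro sum.mono_neutral_left) auto

lemma linear_wd_edge_point:
  assumes "0 \<le> t" "t \<le> 1"
  shows "linear_wd g (edge_point u v t) = (1 - t) * wd g u + t * wd g v"
  using linear_wd_cell[OF _ edge_point_cell[OF assms, of u v], of g]
  by (cases "u = v") (auto simp: edge_point_def vertex_point_def algebra_simps)

text \<open>On an edge the two coordinates change by opposite amounts, and the distances of its ends
  from \<open>g\<close> differ by at most 1.\<close>

lemma linear_wd_le_cell_dist:
  assumes "e \<in> cayley_cells G A" "x \<in> cell_points e" "y \<in> cell_points e" "g \<in> carrier G"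
  shows "\<bar>linear_wd g x - linear_wd g y\<bar> \<le> cell_dist x y"
proof -
  obtain u v where e: "e = {u, v}" and uv: "u \<in> carrier G" "v \<in> carrier G" "wd u v \<le> 1"
    using assms(1) by (rule cayley_cellE)
  have fin: "finite e" using e by simp
  show ?thesis
  proof (cases "u = v")
    case True
    then have "x u = 1" "y u = 1" using assms(2,3) e unfolding cell_points_def by auto
    then show ?thesis
      using linear_wd_cell[OF fin assms(2), of g] linear_wd_cell[OF fin assms(3), of g]
        cell_dist_sum[OF fin assms(2,3)] e True by simp
  next
    case False
    define t where "t = x u - y u"
    have v: "x v - y v = - t"
      using assms(2,3) e False unfolding cell_points_def t_def by auto
    have "linear_wd g x - linear_wd g y = (x u - y u) * wd g u + (x v - y v) * wd g v"
      using linear_wd_cell[OF fin assms(2), of g] linear_wd_cell[OF fin assms(3), of g] e False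
      by (simp add: algebra_simps)
    also have "\<dots> = t * (wd g u - wd g v)" unfolding v t_def by (simp add: algebra_simps)
    finally have "\<bar>linear_wd g x - linear_wd g y\<bar> = \<bar>t\<bar> * \<bar>wd g u - wd g v\<bar>"
      by (simp add: abs_mult)
    also have "\<dots> \<le> \<bar>t\<bar> * 1"
      using triangle[OF assms(4) uv(1,2)] triangle[OF assms(4) uv(2,1)] commute[of u v] uv(3)
      by (intro mult_left_mono) auto
    also have "\<bar>t\<bar> * 1 = cell_dist x y"
      using cell_dist_sum[OF fin assms(2,3)] e False v t_def by simp
    finally show ?thesis .
  qed
qed

lemma linear_wd_le_chain_lengths:
  assumes "s \<in> chain_lengths G A x y" "g \<in> carrier G"
  shows "\<bar>linear_wd g x - linear_wd g y\<bar> \<le> s"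
  using assms(1)
proof (induction rule: chain_lengths_induct)
  case (step s y z e)
  then show ?case using linear_wd_le_cell_dist[OF step(2-4) assms(2)] step(5) by linarith
qed simp

lemma linear_wd_le_realization_dist:
  assumes "chain_lengths G A x y \<noteq> {}" "g \<in> carrier G"
  shows "\<bar>linear_wd g x - linear_wd g y\<bar> \<le> realization_dist G A x y"
  unfolding realization_dist_eq
  using assms linear_wd_le_chain_lengths by (intro cInf_greatest) auto

text \<open>The path is cut at the vertices between \<open>s\<close> and \<open>t\<close>.
  Distinctness is essential: at a repeated vertex the path stands still while the parameter
  advances.\<close>

lemma chain_lengths_realization_path:
  assumes "cayley_path G A n c" and distinct: "\<And>i. i < n \<Longrightarrow> c i \<noteq> c (Suc i)"
    and "0 \<le> s" "s \<le> t" "t \<le> real n"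
  shows "t - s \<in> chain_lengths G A (realization_path c s) (realization_path c t)"
proof -
  let ?S = "\<lambda>s t. t - s \<in> chain_lengths G A (realization_path c s) (realization_path c t)"
  have edge: "?S s t" if "i < n" "real i \<le> s" "s \<le> t" "t \<le> real i + 1" for i s t
  proof -
    have "{c i, c (Suc i)} \<in> cayley_cells G A" by (rule cayley_path_cell[OF assms(1) \<open>i < n\<close>])
    then show ?thesis
      using chain_lengths_cell[of "{c i, c (Suc i)}" G A "realization_path c s" "realization_path c t"]
        cell_dist_edge_point[OF distinct[OF \<open>i < n\<close>], of "s - real i" "t - real i"] that
        edge_point_cell[of "s - real i" "c i" "c (Suc i)"] edge_point_cell[of "t - real i" "c i" "c (Suc i)"]
        realization_path_edge[of i s c] realization_path_edge[of i t c] by auto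
  qed
  have trans: "?S s u" if "?S s t" "?S t u" for s t u
    using chain_lengths_trans[OF that] by simp
  have vertices: "?S (real i) (real j)" if "i \<le> j" "j \<le> n" for i j
    using that
  proof (induction j rule: dec_induct)
    case base
    then show ?case by (simp add: chain_lengths_refl)
  next
    case (step j)
    then have "?S (real i) (real j)" "?S (real j) (real (Suc j))"
      using edge[of j "real j" "real (Suc j)"] by auto
    then show ?case by (rule trans)
  qed
  define i where "i = nat \<lfloor>s\<rfloor>" define j where "j = nat \<lfloor>t\<rfloor>"
  have i: "real i \<le> s" "s < real i + 1" and j: "real j \<le> t" "t < real j + 1"
    unfolding i_def j_def using assms(3,4) by linarith+
  have "i \<le> j" "j \<le> n" using i j assms(4,5) by linarith+
  show ?thesis
  proof (cases "s = t")
    case True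
    then show ?thesis by (simp add: chain_lengths_refl)
  next
    case False
    then have st: "s < t" using assms(4) by simp
    show ?thesis
    proof (cases "i = j")
      case True
      then show ?thesis using edge[of i s t] i j st assms(5) by simp
    next
      case False
      then have "Suc i \<le> j" using \<open>i \<le> j\<close> by simp
      then have "?S s (real (Suc i))" "?S (real (Suc i)) (real j)"
        using edge[of i s "real (Suc i)"] vertices[of "Suc i" j] i \<open>j \<le> n\<close> by auto
      \<comment> \<open>If \<open>t = real j\<close>, then \<open>j = n\<close> is possible and no
        edge starts at \<open>j\<close>.\<close>
      moreover have "?S (real j) t"
        using edge[of j "real j" t] j assms(5) by (cases "t = real j") (auto simp: chain_lengths_refl)
      ultimately show ?thesis using trans by blast
    qed
  qed
qed

text \<open>Connectedness of the realization: each point is joined to a vertex of its cell, and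
  vertices by Cayley paths. It ensures that the infimum defining the metric is over a nonempty
  set.\<close>

lemma chain_lengths_nonempty:
  assumes "x \<in> cayley_realization G A" "y \<in> cayley_realization G A"
  shows "chain_lengths G A x y \<noteq> {}"
proof -
  have vertex: "\<exists>u\<in>carrier G. \<exists>s. s \<in> chain_lengths G A x (vertex_point u)"
    if x: "x \<in> cayley_realization G A" for x
  proof -
    obtain e where e: "e \<in> cayley_cells G A" "x \<in> cell_points e"
      using x unfolding cayley_realization_def by blast
    moreover obtain u v where "e = {u, v}" "u \<in> carrier G" using e(1) by (rule cayley_cellE)
    moreover from this have "vertex_point u \<in> cell_points e" using edge_point_cell[of 0 u v] by simp
    ultimately show ?thesis using chain_lengths_cell by blast
  qed
  obtain u v s t where uv: "u \<in> carrier G" "v \<in> carrier G"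
    "s \<in> chain_lengths G A x (vertex_point u)" "t \<in> chain_lengths G A y (vertex_point v)"
    using vertex assms by meson
  obtain n c where "cayley_path G A n c" and c: "discrete_geodesic (carrier G) wd u v n c"
    using uv(1,2) by (rule cayley_path_if_word_dist)
  moreover have "c i \<noteq> c (Suc i)" if "i < n" for i
    using discrete_geodesicD(4)[OF c, of i "Suc i"] zero[of "c i" "c (Suc i)"]
      discrete_geodesicD(3)[OF c] that by force
  ultimately have "real n - 0 \<in> chain_lengths G A (realization_path c 0) (realization_path c (real n))"
    by (intro chain_lengths_realization_path[of n]) auto
  then have "real n \<in> chain_lengths G A (vertex_point u) (vertex_point v)"
    using realization_path_vertex[of c 0] realization_path_vertex[of c n] discrete_geodesicD(1,2)[OF c]
    by simp
  then show ?thesis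
    using chain_lengths_trans[OF uv(3) chain_lengths_trans[OF _ chain_lengths_sym[OF uv(4)]]] by blast
qed

lemma realization_path_in_realization:
  assumes "discrete_geodesic (carrier G) wd g h n c" "0 \<le> t" "t \<le> real n"
  shows "realization_path c t \<in> cayley_realization G A"
proof (cases "t = real n")
  case True
  then show ?thesis
    using realization_path_vertex[of c n] edge_point_cell[of 0 h h] discrete_geodesicD[OF assms(1)]
    unfolding cayley_realization_def cayley_cells_def by auto
next
  case False
  define i where "i = nat \<lfloor>t\<rfloor>"
  have i: "real i \<le> t" "t < real i + 1" unfolding i_def using assms(2) by linarith+
  then have "i < n" using assms(3) False by linarith
  then have "{c i, c (Suc i)} \<in> cayley_cells G A"
    by (rule cayley_path_cell[OF cayley_path_if_discrete_geodesic[OF assms(1)]])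
  moreover have "realization_path c t \<in> cell_points {c i, c (Suc i)}"
    using realization_path_edge[of i t c] edge_point_cell[of "t - real i"] i by simp
  ultimately show ?thesis unfolding cayley_realization_def by blast
qed

text \<open>Following the path gives the upper bound on distances. The lower bound holds because
  \<open>linear_wd g\<close> equals \<open>t\<close> at parameter \<open>t\<close> and is
  1-Lipschitz.\<close>

lemma geodesic_segment_realization_path:
  assumes "discrete_geodesic (carrier G) wd g h n c"
  shows "geodesic_segment (cayley_realization G A) (realization_dist G A)
    (vertex_point g) (vertex_point h) (realization_path c ` {0..real n})"
proof -
  note c = discrete_geodesicD[OF assms]
  have distinct: "c i \<noteq> c (Suc i)" if "i < n" for i
    using c(4)[of i "Suc i"] zero[of "c i" "c (Suc i)"] c(3) that by force
  have F: "linear_wd g (realization_path c t) = t" if "0 \<le> t" "t \<le> real n" for t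
  proof (cases "t = real n")
    case True
    then show ?thesis
      using realization_path_vertex[of c n] linear_wd_edge_point[of 0 g h h] c by simp
  next
    case False
    define i where "i = nat \<lfloor>t\<rfloor>"
    have i: "real i \<le> t" "t < real i + 1" unfolding i_def using that by linarith+
    then have "i < n" using that False by linarith
    then show ?thesis
      using i linear_wd_edge_point[of "t - real i" g "c i" "c (Suc i)"]
        realization_path_edge[of i t c] c(8)[of i] c(8)[of "Suc i"] by (simp add: algebra_simps)
  qed
  have le: "realization_dist G A (realization_path c s) (realization_path c t) = \<bar>s - t\<bar>"
    if "s \<in> {0..real n}" "t \<in> {0..real n}" for s t
  proof (rule antisym)
    have "\<bar>s - t\<bar> \<in> chain_lengths G A (realization_path c s) (realization_path c t)"
    proof (cases "s \<le> t")
      case True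
      then show ?thesis
        using chain_lengths_realization_path[OF cayley_path_if_discrete_geodesic[OF assms] distinct, of s t]
          that by simp
    next
      case False
      then show ?thesis
        using chain_lengths_realization_path[OF cayley_path_if_discrete_geodesic[OF assms] distinct, of t s]
          that chain_lengths_sym by force
    qed
    then show "realization_dist G A (realization_path c s) (realization_path c t) \<le> \<bar>s - t\<bar>"
      by (rule realization_dist_le)
  next
    show "\<bar>s - t\<bar> \<le> realization_dist G A (realization_path c s) (realization_path c t)"
      using linear_wd_le_realization_dist[OF chain_lengths_nonempty c(5)]
        realization_path_in_realization[OF assms] F that by fastforce
  qed
  have ends: "realization_path c 0 = vertex_point g" "realization_path c (real n) = vertex_point h"
    using realization_path_vertex[of c 0] realization_path_vertex[of c n] c by simp_all
  then have "realization_dist G A (vertex_point g) (vertex_point h) = real n"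
    using le[of 0 "real n"] by simp
  then show ?thesis
    unfolding geodesic_segment_def using ends le realization_path_in_realization[OF assms]
    by (intro exI[of _ "realization_path c"]) auto
qed

text \<open>Since \<open>linear_wd (c1 i)\<close> is affine on edges, one of the endpoints of the edge containing a
  nearby point of another side is at least as near.\<close>

lemma discrete_thin_triangles:
  assumes hyp: "delta_hyperbolic (cayley_realization G A) (realization_dist G A) \<delta>"
    and c1: "discrete_geodesic (carrier G) wd x y n1 c1"
    and c2: "discrete_geodesic (carrier G) wd y z n2 c2"
    and c3: "discrete_geodesic (carrier G) wd z x n3 c3" and i: "i \<le> n1"
  shows "(\<exists>j\<le>n2. wd (c1 i) (c2 j) \<le> \<delta>) \<or> (\<exists>j\<le>n3. wd (c1 i) (c3 j) \<le> \<delta>)"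
proof -
  have V: "vertex_point v \<in> cayley_realization G A" if "v \<in> carrier G" for v
    using edge_point_cell[of 0 v v] that unfolding cayley_realization_def cayley_cells_def by auto
  have round: "\<exists>j\<le>n. wd g (c j) \<le> \<delta>"
    if c: "discrete_geodesic (carrier G) wd u v n c" and g: "g \<in> carrier G"
      and t: "0 \<le> t" "t \<le> real n"
      and near: "realization_dist G A (vertex_point g) (realization_path c t) \<le> \<delta>" for g u v n c t
  proof -
    have "\<bar>linear_wd g (vertex_point g) - linear_wd g (realization_path c t)\<bar> \<le> \<delta>"
      using linear_wd_le_realization_dist[OF chain_lengths_nonempty[OF V[OF g]
          realization_path_in_realization[OF c t]] g] near by linarith
    moreover have "linear_wd g (vertex_point g) = 0"
      using linear_wd_edge_point[of 0 g g g] g by simp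
    ultimately have F: "linear_wd g (realization_path c t) \<le> \<delta>" by linarith
    show ?thesis
    proof (cases "t = real n")
      case True
      then show ?thesis
        using F realization_path_vertex[of c n] linear_wd_edge_point[of 0 g "c n" "c n"] by auto
    next
      case False
      define j where "j = nat \<lfloor>t\<rfloor>"
      define r where "r = t - real j"
      have r: "0 \<le> r" "r < 1" unfolding j_def r_def using t by linarith+
      then have "j < n" using t False unfolding r_def by linarith
      have F': "(1 - r) * wd g (c j) + r * wd g (c (Suc j)) \<le> \<delta>"
        using F realization_path_edge[of j t c] linear_wd_edge_point[of r g] r unfolding r_def by simp
      have "wd g (c j) \<le> \<delta> \<or> wd g (c (Suc j)) \<le> \<delta>"
      proof (rule ccontr)
        assume "\<not> ?thesis"
        then have "(1 - r) * \<delta> < (1 - r) * wd g (c j)" "r * \<delta> \<le> r * wd g (c (Suc j))"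
          using r by (auto intro!: mult_left_mono)
        then show False using F' by (simp add: algebra_simps)
      qed
      then show ?thesis using \<open>j < n\<close> by (metis Suc_leI less_imp_le)
    qed
  qed
  have c1i: "c1 i \<in> carrier G" using discrete_geodesicD(3)[OF c1 i] .
  have "vertex_point (c1 i) \<in> realization_path c1 ` {0..real n1}"
    using realization_path_vertex[of c1 i, symmetric] i by auto
  moreover have "realization_path c1 ` {0..real n1} \<subseteq>
      closed_nbhd (cayley_realization G A) (realization_dist G A) \<delta>
        (realization_path c2 ` {0..real n2} \<union> realization_path c3 ` {0..real n3})"
    using hyp[unfolded delta_hyperbolic_def, rule_format, OF V V V, of x y z]
      geodesic_segment_realization_path[OF c1] geodesic_segment_realization_path[OF c2]
      geodesic_segment_realization_path[OF c3] discrete_geodesicD(5,6)[OF c1]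
      discrete_geodesicD(6)[OF c2]
    by blast
  ultimately obtain q where q: "realization_dist G A (vertex_point (c1 i)) q \<le> \<delta>"
    "q \<in> realization_path c2 ` {0..real n2} \<or> q \<in> realization_path c3 ` {0..real n3}"
    unfolding closed_nbhd_def by blast
  from q(2) show ?thesis
  proof
    assume "q \<in> realization_path c2 ` {0..real n2}"
    then show ?thesis using round[OF c2 c1i] q(1) by force
  next
    assume "q \<in> realization_path c3 ` {0..real n3}"
    then show ?thesis using round[OF c3 c1i] q(1) by force
  qed
qed

lemma four_point_if_hyperbolic:
  assumes "delta_hyperbolic (cayley_realization G A) (realization_dist G A) \<delta>" "\<delta> \<ge> 0"
  shows "four_point (carrier G) wd (3 * \<delta> + 1)"
  by (rule four_point_if_thin[OF assms(2)]) (rule discrete_thin_triangles[OF assms(1)])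

end

section \<open>Quasi-isometric embeddings of hyperbolic groups\<close>

lemma hom_word_dist_le:
  assumes "fg_group G A" "fg_group H B" and \<phi>: "\<phi> \<in> hom G H"
  shows "\<exists>L\<ge>1. \<forall>g\<in>carrier G. \<forall>h\<in>carrier G. word_dist H B (\<phi> g) (\<phi> h) \<le> L * word_dist G A g h"
proof -
  interpret G: fg_group G A by fact
  interpret H: fg_group H B by fact
  interpret group_hom G H \<phi> by unfold_locales (rule \<phi>)
  \<comment> \<open>The sum dominates the length of the image of each generator; the summand 1 gives
    \<open>L \<ge> 1\<close> even without generators.\<close>
  define L where "L = 1 + (\<Sum>a\<in>sym_gens G A. H.wd \<one>\<^bsub>H\<^esub> (\<phi> a))"
  have L1: "L \<ge> 1" unfolding L_def by (simp add: sum_nonneg)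
  have gen: "H.wd \<one>\<^bsub>H\<^esub> (\<phi> a) \<le> L" if "a \<in> sym_gens G A" for a
    using member_le_sum[of a "sym_gens G A" "\<lambda>a. H.wd \<one>\<^bsub>H\<^esub> (\<phi> a)"] that G.finite_sym_gens
    unfolding L_def by simp
  have reach: "H.wd (\<phi> g) (\<phi> h) \<le> L * real n" if "G.reach n g h" for n g h
    using that
  proof (induction n arbitrary: h)
    case 0
    then show ?case by (simp add: G.reach_0)
  next
    case (Suc n)
    then obtain k a where k: "G.reach n g k" "a \<in> sym_gens G A" "h = k \<otimes>\<^bsub>G\<^esub> a"
      unfolding G.reach_Suc by blast
    then have c: "g \<in> carrier G" "k \<in> carrier G" "a \<in> carrier G"
      using G.reach_carrier G.sym_gens_closed by auto
    have "H.wd (\<phi> k) (\<phi> h) = H.wd \<one>\<^bsub>H\<^esub> (\<phi> a)"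
      using H.word_dist_translate[of "\<phi> k" "\<one>\<^bsub>H\<^esub>" "\<phi> a"] c k(3) by simp
    then have "H.wd (\<phi> k) (\<phi> h) \<le> L" using gen k(2) by simp
    moreover have "H.wd (\<phi> g) (\<phi> h) \<le> H.wd (\<phi> g) (\<phi> k) + H.wd (\<phi> k) (\<phi> h)"
      using H.triangle c k(3) by simp
    ultimately show ?case using Suc.IH[OF k(1)] by (simp add: algebra_simps)
  qed
  have "H.wd (\<phi> g) (\<phi> h) \<le> L * G.wd g h" if gh: "g \<in> carrier G" "h \<in> carrier G" for g h
  proof -
    obtain n where n: "G.wd g h = real n" "G.reach n g h" by (rule G.word_dist_least[OF gh])
    show ?thesis using reach[OF n(2)] n(1) by simp
  qed
  then show ?thesis using L1 by blast
qed

text \<open>Formulated for two generating sets in order to serve twice: for the identity between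
  \<open>A\<close> and \<open>B\<close>, and for an automorphism with \<open>A\<close> on both
  sides.\<close>

lemma iso_word_dist_bilipschitz:
  assumes "fg_group G A" "fg_group H B" and \<phi>: "\<phi> \<in> iso G H"
  shows "\<exists>L\<ge>1. \<forall>g\<in>carrier G. \<forall>h\<in>carrier G.
    word_dist G A g h / L \<le> word_dist H B (\<phi> g) (\<phi> h) \<and>
    word_dist H B (\<phi> g) (\<phi> h) \<le> L * word_dist G A g h"
proof -
  interpret G: fg_group G A by fact
  interpret H: fg_group H B by fact
  let ?\<psi> = "inv_into (carrier G) \<phi>"
  have bij: "bij_betw \<phi> (carrier G) (carrier H)" and hom: "\<phi> \<in> hom G H"
    using \<phi> unfolding iso_def by auto
  have "?\<psi> \<in> hom H G" using G.iso_set_sym[OF \<phi>] unfolding iso_def by blast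
  then obtain L2 where L2: "L2 \<ge> 1"
    "\<And>g h. g \<in> carrier H \<Longrightarrow> h \<in> carrier H \<Longrightarrow> G.wd (?\<psi> g) (?\<psi> h) \<le> L2 * H.wd g h"
    using hom_word_dist_le[OF assms(2,1)] by blast
  obtain L1 where L1: "L1 \<ge> 1"
    "\<And>g h. g \<in> carrier G \<Longrightarrow> h \<in> carrier G \<Longrightarrow> H.wd (\<phi> g) (\<phi> h) \<le> L1 * G.wd g h"
    using hom_word_dist_le[OF assms(1,2) hom] by blast
  define L where "L = max L1 L2"
  have L: "L \<ge> 1" "L1 \<le> L" "L2 \<le> L" using L1(1) unfolding L_def by auto
  have "G.wd g h / L \<le> H.wd (\<phi> g) (\<phi> h) \<and> H.wd (\<phi> g) (\<phi> h) \<le> L * G.wd g h"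
    if gh: "g \<in> carrier G" "h \<in> carrier G" for g h
  proof
    have "G.wd g h \<le> L2 * H.wd (\<phi> g) (\<phi> h)"
      using L2(2)[of "\<phi> g" "\<phi> h"] gh bij hom
      by (simp add: bij_betw_inv_into_left hom_in_carrier)
    also have "\<dots> \<le> L * H.wd (\<phi> g) (\<phi> h)" using L by (intro mult_right_mono) auto
    finally show "G.wd g h / L \<le> H.wd (\<phi> g) (\<phi> h)" using L(1) by (simp add: field_simps)
    have "L1 * G.wd g h \<le> L * G.wd g h" using L by (intro mult_right_mono) auto
    then show "H.wd (\<phi> g) (\<phi> h) \<le> L * G.wd g h" using L1(2)[OF gh] by linarith
  qed
  then show ?thesis using L(1) by blast
qed

lemma gromov_product_eq: "gromov_product G A p g h = gromov_prod (word_dist G A) p g h"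
  unfolding gromov_product_def gromov_prod_def ..

context fg_group
begin

text \<open>Three estimates are composed: (g|h) at \<open>p\<close> is at most the distance from
  \<open>p\<close> to an \<open>A\<close>-geodesic, hence linear in the \<open>B\<close>-product of
  the images at \<open>\<phi> p\<close>; this is linear in their \<open>A\<close>-product; and
  moving the base point back to \<open>p\<close> costs at most
  \<open>wd (\<phi> p) p\<close>.\<close>

proposition gromov_product_le_if_quasi_isometric:
  assumes "hyperbolic_group G" and p: "p \<in> carrier G"
    and qi: "quasi_isometric_embedding (carrier G) wd (carrier G) wd \<phi>"
  shows "\<exists>P>0. \<exists>Q. \<forall>g\<in>carrier G. \<forall>h\<in>carrier G.
    gromov_product G A p g h \<le> P * gromov_product G A p (\<phi> g) (\<phi> h) + Q"
proof -
  obtain B \<delta> where "finite_generating_set G B" and \<delta>: "\<delta> \<ge> 0"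
    "delta_hyperbolic (cayley_realization G B) (realization_dist G B) \<delta>"
    using assms(1) unfolding hyperbolic_group_def by blast
  then interpret B: fg_group G B by unfold_locales
  have A: "fg_group G A" and B: "fg_group G B" by unfold_locales
  define \<delta>' where "\<delta>' = 3 * \<delta> + 1"
  have four: "four_point (carrier G) B.wd \<delta>'" "\<delta>' \<ge> 0"
    unfolding \<delta>'_def using B.four_point_if_hyperbolic \<delta> by auto
  have "(\<lambda>x. x) \<in> iso G G" unfolding iso_def hom_def by (auto simp: bij_betw_def inj_on_def)
  from iso_word_dist_bilipschitz[OF A B this] obtain M where M: "M \<ge> 1"
    "\<And>g h. g \<in> carrier G \<Longrightarrow> h \<in> carrier G \<Longrightarrow> wd g h / M \<le> B.wd g h"
    "\<And>g h. g \<in> carrier G \<Longrightarrow> h \<in> carrier G \<Longrightarrow> B.wd g h \<le> M * wd g h" by blast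
  have "quasi_isometry (carrier G) wd (carrier G) B.wd (\<lambda>x. x) M 0"
    by unfold_locales (use M in auto)
  from gromov_prod_le_if_four_point[OF this _ _ four]
  obtain P1 Q1 where P1: "P1 > 0" and BA: "\<And>w x y. w \<in> carrier G \<Longrightarrow> x \<in> carrier G \<Longrightarrow>
      y \<in> carrier G \<Longrightarrow> gromov_prod B.wd w x y \<le> P1 * gromov_prod wd w x y + Q1"
    using discrete_geodesic_space_axioms B.discrete_geodesic_space_axioms by blast
  obtain L K where \<phi>: "\<And>x. x \<in> carrier G \<Longrightarrow> \<phi> x \<in> carrier G" and LK: "L \<ge> 1" "K \<ge> 0"
    "\<And>x y. x \<in> carrier G \<Longrightarrow> y \<in> carrier G \<Longrightarrow> 1 / L * wd x y - K \<le> wd (\<phi> x) (\<phi> y)"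
    "\<And>x y. x \<in> carrier G \<Longrightarrow> y \<in> carrier G \<Longrightarrow> wd (\<phi> x) (\<phi> y) \<le> L * wd x y + K"
    using qi unfolding quasi_isometric_embedding_def by (auto simp: Pi_iff)
  \<comment> \<open>The source carries the metric of \<open>A\<close>, the target that of
    \<open>B\<close>; the constants of \<phi> are multiplied by the comparison constant
    \<open>M\<close>.\<close>
  interpret \<phi>: quasi_isometry "carrier G" wd "carrier G" B.wd \<phi> "M * L" "M * K"
  proof unfold_locales
    have "1 * 1 \<le> M * L" using M(1) LK(1) by (intro mult_mono) auto
    then show "M * L \<ge> 1" by simp
    show "M * K \<ge> 0" using M(1) LK(2) by simp
    fix x y assume xy: "x \<in> carrier G" "y \<in> carrier G"
    have "(1 / L * wd x y - K) / M \<le> wd (\<phi> x) (\<phi> y) / M"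
      using LK(3)[OF xy] M(1) by (intro divide_right_mono) auto
    moreover have "(1 / L * wd x y - K) / M = wd x y / (M * L) - K / M"
      using M(1) LK(1) by (simp add: field_simps)
    moreover have "K / M \<le> M * K"
    proof -
      have "K / M \<le> K / 1" using M(1) LK(2) by (intro divide_left_mono) auto
      moreover have "1 * K \<le> M * K" using M(1) LK(2) by (intro mult_right_mono) auto
      ultimately show ?thesis by simp
    qed
    ultimately show "wd x y / (M * L) - M * K \<le> B.wd (\<phi> x) (\<phi> y)"
      using M(2)[OF \<phi>[OF xy(1)] \<phi>[OF xy(2)]] by linarith
    have "M * wd (\<phi> x) (\<phi> y) \<le> M * (L * wd x y + K)"
      using LK(4)[OF xy] M(1) by (intro mult_left_mono) auto
    then show "B.wd (\<phi> x) (\<phi> y) \<le> M * L * wd x y + M * K"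
      using M(3)[OF \<phi>[OF xy(1)] \<phi>[OF xy(2)]] by (simp add: distrib_left)
  qed (use \<phi> in auto)
  obtain P2 Q2 where P2: "P2 > 0" and near: "\<And>x y n c b. discrete_geodesic (carrier G) wd x y n c \<Longrightarrow>
      b \<in> carrier G \<Longrightarrow> \<exists>i\<le>n. wd b (c i) \<le> P2 * gromov_prod B.wd (\<phi> b) (\<phi> x) (\<phi> y) + Q2"
    using \<phi>.geodesic_near_if_gromov_prod_small[OF four] by blast
  have "gromov_prod wd p g h \<le> P2 * P1 * gromov_prod wd p (\<phi> g) (\<phi> h)
      + (P2 * P1 * wd (\<phi> p) p + P2 * Q1 + Q2)"
    if gh: "g \<in> carrier G" "h \<in> carrier G" for g h
  proof -
    obtain n c where c: "discrete_geodesic (carrier G) wd g h n c"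
      using geodesic_exists[OF gh] by blast
    obtain i where "i \<le> n" "wd p (c i) \<le> P2 * gromov_prod B.wd (\<phi> p) (\<phi> g) (\<phi> h) + Q2"
      using near[OF c p] by blast
    then have "gromov_prod wd p g h \<le> P2 * gromov_prod B.wd (\<phi> p) (\<phi> g) (\<phi> h) + Q2"
      using gromov_prod_le_dist_geodesic[OF c _ p] by fastforce
    also have "gromov_prod B.wd (\<phi> p) (\<phi> g) (\<phi> h)
        \<le> P1 * (gromov_prod wd p (\<phi> g) (\<phi> h) + wd (\<phi> p) p) + Q1"
    proof -
      have "P1 * gromov_prod wd (\<phi> p) (\<phi> g) (\<phi> h)
          \<le> P1 * (gromov_prod wd p (\<phi> g) (\<phi> h) + wd (\<phi> p) p)"
        using gromov_prod_basepoint[of "\<phi> p" p "\<phi> g" "\<phi> h"] \<phi> gh p P1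
        by (intro mult_left_mono) auto
      then show ?thesis using BA[of "\<phi> p" "\<phi> g" "\<phi> h"] \<phi> gh p by fastforce
    qed
    finally show ?thesis using P2 by (simp add: algebra_simps)
  qed
  then show ?thesis
    unfolding gromov_product_eq using P1 P2
    by (intro exI[of _ "P2 * P1"] conjI exI[of _ "P2 * P1 * wd (\<phi> p) p + P2 * Q1 + Q2"]) auto
qed

lemma iso_quasi_isometric:
  assumes "\<phi> \<in> iso G G"
  shows "quasi_isometric_embedding (carrier G) wd (carrier G) wd \<phi>"
proof -
  have A: "fg_group G A" by unfold_locales
  obtain L where L: "L \<ge> 1"
    "\<And>g h. g \<in> carrier G \<Longrightarrow> h \<in> carrier G \<Longrightarrow> wd g h / L \<le> wd (\<phi> g) (\<phi> h)"
    "\<And>g h. g \<in> carrier G \<Longrightarrow> h \<in> carrier G \<Longrightarrow> wd (\<phi> g) (\<phi> h) \<le> L * wd g h"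
    using iso_word_dist_bilipschitz[OF A A assms] by blast
  have "\<phi> \<in> carrier G \<rightarrow> carrier G" using assms unfolding iso_def hom_def by simp
  then show ?thesis
    unfolding quasi_isometric_embedding_def
    using L by (intro conjI exI[of _ L] exI[of _ 0]) auto
qed

end

section \<open>Visual metrics and completions\<close>

lemma holder_map_imp_uniformly_continuous_map:
  assumes "holder_map m m' f" shows "uniformly_continuous_map m m' f"
proof -
  interpret Metric_space "mspace m" "mdist m" by simp
  obtain r K where f: "f \<in> mspace m \<rightarrow> mspace m'" and rK: "r > 0" "K > 0"
    "\<And>x y. x \<in> mspace m \<Longrightarrow> y \<in> mspace m \<Longrightarrow> mdist m' (f x) (f y) \<le> K * mdist m x y powr r"
    using assms unfolding holder_map_def by blast
  have "\<exists>\<delta>>0. \<forall>x\<in>mspace m. \<forall>y\<in>mspace m. mdist m y x < \<delta> \<longrightarrow> mdist m' (f y) (f x) < \<epsilon>"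
    if "\<epsilon> > 0" for \<epsilon>
  proof -
    \<comment> \<open>Solves \<open>K * \<delta> powr r = \<epsilon>\<close>.\<close>
    define \<delta> where "\<delta> = (\<epsilon> / K) powr (1 / r)"
    have "\<delta> > 0" unfolding \<delta>_def using that rK by simp
    moreover have "mdist m' (f y) (f x) < \<epsilon>"
      if xy: "x \<in> mspace m" "y \<in> mspace m" "mdist m y x < \<delta>" for x y
    proof -
      have "mdist m y x powr r < \<delta> powr r"
        using xy(3) rK(1) by (intro powr_less_mono2) auto
      also have "\<delta> powr r = \<epsilon> / K" unfolding \<delta>_def using rK \<open>\<epsilon> > 0\<close> by (simp add: powr_powr)
      finally have "K * mdist m y x powr r < \<epsilon>" using rK(2) by (simp add: field_simps)
      then show ?thesis using rK(3)[OF xy(2,1)] by linarith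
    qed
    ultimately show ?thesis by blast
  qed
  then show ?thesis using f unfolding uniformly_continuous_map_def by blast
qed

lemma metric_completion_limit:
  assumes "metric_completion_of m m' \<iota>" "y \<in> mspace m'"
  obtains \<sigma> :: "nat \<Rightarrow> 'a" where "range \<sigma> \<subseteq> mspace m" "(\<lambda>n. mdist m' (\<iota> (\<sigma> n)) y) \<longlonglongrightarrow> 0"
proof -
  interpret Metric_space "mspace m'" "mdist m'" by simp
  have "y \<in> mtopology closure_of (\<iota> ` mspace m)"
    using assms unfolding metric_completion_of_def mtopology_of_def by blast
  then obtain \<tau> where \<tau>: "range \<tau> \<subseteq> \<iota> ` mspace m" "limitin mtopology \<tau> y sequentially"
    unfolding closure_of_sequentially by blast
  then have "\<forall>n. \<exists>x. x \<in> mspace m \<and> \<tau> n = \<iota> x" by blast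
  then obtain \<sigma> where \<sigma>: "\<And>n. \<sigma> n \<in> mspace m" "\<And>n. \<tau> n = \<iota> (\<sigma> n)" by metis
  have "(\<lambda>n. mdist m' (\<tau> n) y) \<longlonglongrightarrow> 0" using \<tau>(2) unfolding limitin_metric_dist_null by blast
  then show ?thesis using \<sigma> by (intro that[of \<sigma>]) auto
qed

lemma (in Metric_space) tendsto_dist:
  assumes "\<And>n. \<sigma> n \<in> M" "\<And>n. \<tau> n \<in> M" "x \<in> M" "y \<in> M"
    and "(\<lambda>n. d (\<sigma> n) x) \<longlonglongrightarrow> 0" "(\<lambda>n. d (\<tau> n) y) \<longlonglongrightarrow> 0"
  shows "(\<lambda>n. d (\<sigma> n) (\<tau> n)) \<longlonglongrightarrow> d x y"
proof -
  have "\<bar>d (\<sigma> n) (\<tau> n) - d x y\<bar> \<le> d (\<sigma> n) x + d (\<tau> n) y" for n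
    using triangle[of "\<sigma> n" x "\<tau> n"] triangle[of x y "\<tau> n"] triangle[of x "\<sigma> n" y]
      triangle[of "\<sigma> n" "\<tau> n" y] assms(1-4) commute[of x "\<sigma> n"] commute[of y "\<tau> n"] by simp
  moreover have "(\<lambda>n. d (\<sigma> n) x + d (\<tau> n) y) \<longlonglongrightarrow> 0"
    using tendsto_add[OF assms(5,6)] by simp
  ultimately have "(\<lambda>n. d (\<sigma> n) (\<tau> n) - d x y) \<longlonglongrightarrow> 0"
    by (intro Lim_null_comparison[of "\<lambda>n. d (\<sigma> n) (\<tau> n) - d x y" "\<lambda>n. d (\<sigma> n) x + d (\<tau> n) y"])
      simp_all
  then show ?thesis by (simp add: LIM_zero_iff)
qed

lemma uniformly_continuous_map_extends_to_completion:
  assumes compl: "metric_completion_of m m' \<iota>" and f: "uniformly_continuous_map m m f"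
  obtains \<Phi> where "uniformly_continuous_map m' m' \<Phi>" "extends_along m \<iota> f \<Phi>"
proof -
  interpret Metric_space "mspace m" "mdist m" by simp
  interpret Y: Metric_space "mspace m'" "mdist m'" by simp
  have \<iota>: "\<And>x. x \<in> mspace m \<Longrightarrow> \<iota> x \<in> mspace m'"
    "\<And>x y. x \<in> mspace m \<Longrightarrow> y \<in> mspace m \<Longrightarrow> mdist m' (\<iota> x) (\<iota> y) = mdist m x y"
    and "mcomplete_of m'" and closure: "mtopology_of m' closure_of (\<iota> ` mspace m) = mspace m'"
    using compl unfolding metric_completion_of_def by (auto simp: Pi_iff)
  have "inj_on \<iota> (mspace m)"
  proof (rule inj_onI)
    fix x y assume "x \<in> mspace m" "y \<in> mspace m" "\<iota> x = \<iota> y"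
    then show "x = y" using \<iota>(1)[of x] \<iota>(2)[of x y] by simp
  qed
  \<comment> \<open>The completion is an arbitrary one, so \<open>f\<close> is first transported
    along \<iota> to a map on the dense image, where the extension theorem for closures
    applies.\<close>
  define g where "g y = \<iota> (f (inv_into (mspace m) \<iota> y))" for y
  have g: "g (\<iota> x) = \<iota> (f x)" if "x \<in> mspace m" for x
    unfolding g_def using \<open>inj_on \<iota> (mspace m)\<close> that by simp
  have fM: "f x \<in> mspace m" if "x \<in> mspace m" for x
    using f that unfolding uniformly_continuous_map_def by blast
  have "uniformly_continuous_map (submetric m' (\<iota> ` mspace m)) m' g"
    unfolding uniformly_continuous_map_def mspace_submetric mdist_submetric
  proof (intro conjI allI impI)
    show "g \<in> \<iota> ` mspace m \<inter> mspace m' \<rightarrow> mspace m'" using g \<iota>(1) fM by auto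
    fix \<epsilon> :: real assume "\<epsilon> > 0"
    then obtain \<delta> where \<delta>: "\<delta> > 0" "\<And>x y. x \<in> mspace m \<Longrightarrow> y \<in> mspace m \<Longrightarrow> mdist m y x < \<delta> \<Longrightarrow>
        mdist m (f y) (f x) < \<epsilon>"
      using f unfolding uniformly_continuous_map_def by meson
    then show "\<exists>\<delta>>0. \<forall>x\<in>\<iota> ` mspace m \<inter> mspace m'. \<forall>y\<in>\<iota> ` mspace m \<inter> mspace m'.
        mdist m' y x < \<delta> \<longrightarrow> mdist m' (g y) (g x) < \<epsilon>"
      using g \<iota>(2) fM by (intro exI[of _ \<delta>]) auto
  qed
  then obtain \<Phi> where
    "uniformly_continuous_map (submetric m' (mtopology_of m' closure_of (\<iota> ` mspace m))) m' \<Phi>"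
    and \<Phi>: "\<And>y. y \<in> \<iota> ` mspace m \<Longrightarrow> \<Phi> y = g y"
    using uniformly_continuous_map_extends_to_closure_of[OF \<open>mcomplete_of m'\<close>] by blast
  then have "uniformly_continuous_map m' m' \<Phi>" unfolding closure by simp
  moreover have "extends_along m \<iota> f \<Phi>" unfolding extends_along_def using \<Phi> g by simp
  ultimately show ?thesis by (rule that)
qed

text \<open>The uniformly continuous extension inherits the estimate with the same exponent and
  constant, both sides being limits along sequences from the dense image.\<close>

lemma holder_map_extends_to_completion:
  assumes compl: "metric_completion_of m m' \<iota>" and f: "holder_map m m f"
  obtains \<Phi> where "holder_map m' m' \<Phi>" "extends_along m \<iota> f \<Phi>"
proof -
  interpret Y: Metric_space "mspace m'" "mdist m'" by simp
  obtain \<Phi> where uc: "uniformly_continuous_map m' m' \<Phi>" and ext: "extends_along m \<iota> f \<Phi>"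
    using uniformly_continuous_map_extends_to_completion[OF compl
        holder_map_imp_uniformly_continuous_map[OF f]] .
  have \<iota>: "\<And>x. x \<in> mspace m \<Longrightarrow> \<iota> x \<in> mspace m'"
    "\<And>x y. x \<in> mspace m \<Longrightarrow> y \<in> mspace m \<Longrightarrow> mdist m' (\<iota> x) (\<iota> y) = mdist m x y"
    using compl unfolding metric_completion_of_def by (auto simp: Pi_iff)
  obtain r K where fM: "f \<in> mspace m \<rightarrow> mspace m" and rK: "r > 0" "K > 0"
    "\<And>x y. x \<in> mspace m \<Longrightarrow> y \<in> mspace m \<Longrightarrow> mdist m (f x) (f y) \<le> K * mdist m x y powr r"
    using f unfolding holder_map_def by blast
  have \<Phi>M: "\<Phi> x \<in> mspace m'" if "x \<in> mspace m'" for x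
    using uc that unfolding uniformly_continuous_map_def by blast
  have "mdist m' (\<Phi> x) (\<Phi> y) \<le> K * mdist m' x y powr r"
    if xy: "x \<in> mspace m'" "y \<in> mspace m'" for x y
  proof -
    obtain \<sigma> where \<sigma>: "range \<sigma> \<subseteq> mspace m" "(\<lambda>n. mdist m' (\<iota> (\<sigma> n)) x) \<longlonglongrightarrow> 0"
      by (rule metric_completion_limit[OF compl xy(1)])
    obtain \<tau> where \<tau>: "range \<tau> \<subseteq> mspace m" "(\<lambda>n. mdist m' (\<iota> (\<tau> n)) y) \<longlonglongrightarrow> 0"
      by (rule metric_completion_limit[OF compl xy(2)])
    have lim: "(\<lambda>n. mdist m' (\<iota> (\<sigma> n)) (\<iota> (\<tau> n))) \<longlonglongrightarrow> mdist m' x y"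
      using \<sigma> \<tau> xy \<iota>(1) by (intro Y.tendsto_dist) (auto simp: image_subset_iff)
    have image: "(\<lambda>n. mdist m' (\<Phi> (\<iota> (\<sigma> n))) (\<Phi> z)) \<longlonglongrightarrow> 0"
      if "range \<sigma> \<subseteq> mspace m" "(\<lambda>n. mdist m' (\<iota> (\<sigma> n)) z) \<longlonglongrightarrow> 0" "z \<in> mspace m'" for \<sigma> z
      using that \<iota>(1) by (intro ucmap_A[OF uc]) (auto simp: image_subset_iff)
    have lim': "(\<lambda>n. mdist m' (\<Phi> (\<iota> (\<sigma> n))) (\<Phi> (\<iota> (\<tau> n)))) \<longlonglongrightarrow> mdist m' (\<Phi> x) (\<Phi> y)"
      using \<sigma> \<tau> xy \<iota>(1) \<Phi>M image by (intro Y.tendsto_dist) (auto simp: image_subset_iff)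
    \<comment> \<open>The limit of the base is 0 when \<open>x = y\<close>; positivity of
      \<open>r\<close> keeps the power continuous there.\<close>
    have "(\<lambda>n. mdist m' (\<iota> (\<sigma> n)) (\<iota> (\<tau> n)) powr r) \<longlonglongrightarrow> mdist m' x y powr r"
      using lim rK(1) by (intro tendsto_powr') auto
    then have "(\<lambda>n. K * mdist m' (\<iota> (\<sigma> n)) (\<iota> (\<tau> n)) powr r) \<longlonglongrightarrow> K * mdist m' x y powr r"
      by (rule tendsto_mult_left)
    moreover have "mdist m' (\<Phi> (\<iota> (\<sigma> n))) (\<Phi> (\<iota> (\<tau> n))) \<le> K * mdist m' (\<iota> (\<sigma> n)) (\<iota> (\<tau> n)) powr r" for n
      using ext \<sigma>(1) \<tau>(1) \<iota>(2) fM rK(3) unfolding extends_along_def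
      by (simp add: Pi_iff image_subset_iff)
    ultimately show ?thesis using LIMSEQ_le[OF lim'] by blast
  qed
  then have "holder_map m' m' \<Phi>" unfolding holder_map_def using \<Phi>M rK(1,2) by blast
  then show ?thesis using ext by (rule that)
qed

section \<open>Visual metrics on a finitely generated group\<close>

locale visual_metric = fg_group +
  fixes p \<gamma> T d
  assumes p: "p \<in> carrier G" and \<gamma>: "\<gamma> > 0" and T: "T \<ge> 1"
    and visual: "d \<in> visual_metrics G A p \<gamma> T"
begin

sublocale V: Metric_space "carrier G" "mdist d"
  using visual Metric_space_mspace_mdist[of d] unfolding visual_metrics_def by simp

lemma mspace_d: "mspace d = carrier G"
  using visual unfolding visual_metrics_def by simp

text \<open>The diagonal is included, unlike in the reverse inequality: there the distance is 0 and
  the bound positive.\<close>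

lemma mdist_le:
  assumes "g \<in> carrier G" "h \<in> carrier G"
  shows "mdist d g h \<le> T * exp (- \<gamma> * gromov_product G A p g h)"
proof (cases "g = h")
  case True
  then show ?thesis using assms T by simp
next
  case False
  then show ?thesis using visual assms unfolding visual_metrics_def visual_rho_def by simp
qed

lemma exp_gromov_product_le:
  assumes "g \<in> carrier G" "h \<in> carrier G" "g \<noteq> h"
  shows "exp (- \<gamma> * gromov_product G A p g h) \<le> T * mdist d g h"
proof -
  have "1 / T * exp (- \<gamma> * gromov_product G A p g h) \<le> mdist d g h"
    using visual assms unfolding visual_metrics_def visual_rho_def by simp
  then show ?thesis using T by (simp add: field_simps)
qed

text \<open>Under exponentiation the factor \<open>P\<close> turns into the exponent 1/P and the
  additive constant \<open>Q\<close> into a factor.\<close>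

lemma holder_map_if_gromov_product_le:
  assumes \<phi>: "\<And>g. g \<in> carrier G \<Longrightarrow> \<phi> g \<in> carrier G" and "P > 0"
    and le: "\<And>g h. g \<in> carrier G \<Longrightarrow> h \<in> carrier G \<Longrightarrow>
      gromov_product G A p g h \<le> P * gromov_product G A p (\<phi> g) (\<phi> h) + Q"
  shows "holder_map d d \<phi>"
proof -
  \<comment> \<open>\<open>T\<close> comes from the upper visual bound at the images,
    \<open>T powr (1 / P)\<close> from the lower one at \<open>g\<close> and
    \<open>h\<close>.\<close>
  define K where "K = T * exp (\<gamma> * Q / P) * T powr (1 / P)"
  have K: "K > 0" unfolding K_def using T by simp
  have "mdist d (\<phi> g) (\<phi> h) \<le> K * mdist d g h powr (1 / P)"
    if gh: "g \<in> carrier G" "h \<in> carrier G" for g h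
  proof (cases "g = h")
    case True
    then show ?thesis using \<phi> gh by simp
  next
    case False
    let ?x = "gromov_product G A p g h"
    have "(?x - Q) / P \<le> gromov_product G A p (\<phi> g) (\<phi> h)"
      using le[OF gh] \<open>P > 0\<close> by (simp add: field_simps)
    then have "\<gamma> * ((?x - Q) / P) \<le> \<gamma> * gromov_product G A p (\<phi> g) (\<phi> h)"
      using \<gamma> by (intro mult_left_mono) auto
    then have "- \<gamma> * gromov_product G A p (\<phi> g) (\<phi> h) \<le> - \<gamma> * ((?x - Q) / P)" by simp
    also have "\<dots> = \<gamma> * Q / P + (- \<gamma> * ?x) * (1 / P)"
      using \<open>P > 0\<close> by (simp add: field_simps)
    finally have "exp (- \<gamma> * gromov_product G A p (\<phi> g) (\<phi> h))
        \<le> exp (\<gamma> * Q / P) * exp ((- \<gamma> * ?x) * (1 / P))"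
      by (simp add: exp_add[symmetric])
    also have "exp ((- \<gamma> * ?x) * (1 / P)) = exp (- \<gamma> * ?x) powr (1 / P)"
      by (simp add: powr_def mult.commute)
    also have "\<dots> \<le> (T * mdist d g h) powr (1 / P)"
      using exp_gromov_product_le[OF gh False] \<open>P > 0\<close> by (intro powr_mono2) auto
    also have "\<dots> = T powr (1 / P) * mdist d g h powr (1 / P)"
      using T by (simp add: powr_mult)
    finally have "T * exp (- \<gamma> * gromov_product G A p (\<phi> g) (\<phi> h)) \<le> K * mdist d g h powr (1 / P)"
      unfolding K_def using T by (simp add: mult.assoc)
    then show ?thesis using mdist_le[OF \<phi>[OF gh(1)] \<phi>[OF gh(2)]] by linarith
  qed
  then show ?thesis
    unfolding holder_map_def mspace_d using \<phi> K \<open>P > 0\<close>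
    by (intro conjI exI[of _ "1 / P"] exI[of _ K]) auto
qed

text \<open>\<open>v\<close> is where a geodesic from \<open>p\<close> to \<open>g\<close> leaves
  the ball of radius \<open>R\<close>, or \<open>g\<close> itself if it stays inside. Finite balls
  leave only finitely many values of \<open>v\<close>.\<close>

lemma word_ball_prefix:
  assumes g: "g \<in> carrier G"
  shows "\<exists>v\<in>carrier G. wd p v \<le> real R \<and> (g \<noteq> v \<longrightarrow> wd p v = real R) \<and> wd p v + wd v g = wd p g"
proof (cases "wd p g \<le> real R")
  case True
  then show ?thesis using g by (intro bexI[of _ g]) auto
next
  case False
  obtain n c where c: "discrete_geodesic (carrier G) wd p g n c" using geodesic_exists[OF p g] by blast
  then have "R \<le> n" using False discrete_geodesicD(7)[OF c] by simp
  then show ?thesis using discrete_geodesicD(3,7-9)[OF c] by (intro bexI[of _ "c R"]) auto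
qed

text \<open>Elements whose geodesics from \<open>p\<close> pass through a common point of the sphere of radius
  \<open>R\<close> have Gromov product at least \<open>R\<close>, and the spheres are finite.\<close>

lemma mtotally_bounded_carrier: "V.mtotally_bounded (carrier G)"
  unfolding V.mtotally_bounded_def
proof (intro allI impI)
  fix \<epsilon> :: real assume "\<epsilon> > 0"
  obtain R :: nat where R: "ln (T / \<epsilon>) / \<gamma> < real R" using reals_Archimedean2 by blast
  have "ln (T / \<epsilon>) < \<gamma> * real R" using R \<gamma> by (simp add: field_simps)
  then have "exp (ln (T / \<epsilon>)) < exp (\<gamma> * real R)" by simp
  then have "T / \<epsilon> < exp (\<gamma> * real R)" using T \<open>\<epsilon> > 0\<close> by simp
  then have small: "T * exp (- \<gamma> * real R) < \<epsilon>"
    using \<open>\<epsilon> > 0\<close> by (simp add: field_simps exp_minus)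
  obtain v where v: "\<And>g. g \<in> carrier G \<Longrightarrow> v g \<in> carrier G \<and> wd p (v g) \<le> real R \<and>
      (g \<noteq> v g \<longrightarrow> wd p (v g) = real R) \<and> wd p (v g) + wd (v g) g = wd p g"
    using word_ball_prefix[of _ R] by metis
  have close: "mdist d g h < \<epsilon>" if gh: "g \<in> carrier G" "h \<in> carrier G" "v g = v h" for g h
  proof (cases "g = h")
    case True
    then show ?thesis using gh \<open>\<epsilon> > 0\<close> by simp
  next
    case False
    \<comment> \<open>Distinct elements with the same prefix cannot both equal it, so the prefix
      lies on the sphere.\<close>
    then have "wd p (v g) = real R" using v[OF gh(1)] v[OF gh(2)] gh(3) by auto
    then have "real R \<le> gromov_product G A p g h"
      unfolding gromov_product_def
      using v[OF gh(1)] v[OF gh(2)] gh triangle[of g "v g" h] commute[of g "v g"] by simp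
    then have "T * exp (- \<gamma> * gromov_product G A p g h) \<le> T * exp (- \<gamma> * real R)"
      using T \<gamma> by simp
    then show ?thesis using mdist_le[OF gh(1,2)] small by linarith
  qed
  have "v ` carrier G \<subseteq> {h \<in> carrier G. wd p h \<le> real R}" using v by blast
  then have fin: "finite (v ` carrier G)" using finite_word_ball[OF p] finite_subset by blast
  \<comment> \<open>One representative for each prefix; these are the centres of the covering
    balls.\<close>
  define s where "s = inv_into (carrier G) v"
  have s: "s (v g) \<in> carrier G" "v (s (v g)) = v g" if "g \<in> carrier G" for g
    unfolding s_def using that by (simp_all add: inv_into_into f_inv_into_f)
  show "\<exists>K. finite K \<and> K \<subseteq> carrier G \<and> carrier G \<subseteq> (\<Union>x\<in>K. V.mball x \<epsilon>)"
  proof (intro exI conjI)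
    show "finite (s ` v ` carrier G)" using fin by simp
    show "s ` v ` carrier G \<subseteq> carrier G" using s by blast
    show "carrier G \<subseteq> (\<Union>x\<in>s ` v ` carrier G. V.mball x \<epsilon>)"
      using close s by (auto simp: V.in_mball)
  qed
qed

text \<open>Total boundedness gives a Cauchy subsequence of any injective sequence, and finite balls
  drive it to infinity. Right multiplication by \<open>x\<close> moves each term by the fixed word
  distance \<open>wd \<one> x\<close>, so the product of \<open>k n\<close> and
  \<open>k n \<otimes> x\<close> tends to infinity and their visual distance to 0.\<close>

lemma infinite_subset_Cauchy_sequence:
  assumes "infinite S" "S \<subseteq> carrier G"
  obtains k where "range k \<subseteq> S" "V.MCauchy k"
    "\<forall>x\<in>carrier G. (\<lambda>n. mdist d (k n) (k n \<otimes> x)) \<longlonglongrightarrow> 0"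
proof -
  obtain s :: "nat \<Rightarrow> 'a" where s: "inj s" "range s \<subseteq> S"
    using infinite_countable_subset[OF assms(1)] by blast
  then obtain r :: "nat \<Rightarrow> nat" where r: "strict_mono r" "V.MCauchy (s \<circ> r)"
    using mtotally_bounded_carrier assms(2) unfolding V.mtotally_bounded_sequentially by blast
  define k where "k = s \<circ> r"
  have kS: "k n \<in> S" for n using s(2) unfolding k_def by auto
  then have kG: "k n \<in> carrier G" for n using assms(2) by blast
  have "inj k" unfolding k_def using s(1) r(1) by (simp add: inj_compose strict_mono_imp_inj_on)
  have large: "filterlim (\<lambda>n. wd p (k n)) at_top sequentially"
    unfolding filterlim_at_top
  proof
    fix Z
    have "{n. wd p (k n) \<le> Z} \<subseteq> k -` {h \<in> carrier G. wd p h \<le> Z}" using kG by auto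
    then have "finite {n. wd p (k n) \<le> Z}"
      using finite_vimageI[OF finite_word_ball[OF p] \<open>inj k\<close>] finite_subset by blast
    then obtain N where "\<forall>n\<in>{n. wd p (k n) \<le> Z}. n < N" using finite_nat_set_iff_bounded by auto
    then have "Z \<le> wd p (k n)" if "n \<ge> N" for n using that by (metis (mono_tags) linear mem_Collect_eq not_le)
    then show "eventually (\<lambda>n. Z \<le> wd p (k n)) sequentially" unfolding eventually_sequentially by blast
  qed
  have "(\<lambda>n. mdist d (k n) (k n \<otimes> x)) \<longlonglongrightarrow> 0" if x: "x \<in> carrier G" for x
  proof (rule tendsto_sandwich[where f = "\<lambda>_. 0"])
    let ?b = "\<lambda>n. T * exp (- \<gamma> * (wd p (k n) - wd \<one> x))"
    have "mdist d (k n) (k n \<otimes> x) \<le> ?b n" for n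
    proof -
      have "wd (k n) (k n \<otimes> x) = wd \<one> x" using word_dist_translate[of "k n" \<one> x] kG x by simp
      then have "wd p (k n) - wd \<one> x \<le> gromov_product G A p (k n) (k n \<otimes> x)"
        using gromov_prod_ge[of p "k n" "k n \<otimes> x"] p kG x
        unfolding gromov_product_def gromov_prod_def by simp
      then have "T * exp (- \<gamma> * gromov_product G A p (k n) (k n \<otimes> x)) \<le> ?b n" using T \<gamma> by simp
      then show ?thesis using mdist_le[of "k n" "k n \<otimes> x"] kG x by fastforce
    qed
    then show "\<forall>\<^sub>F n in sequentially. mdist d (k n) (k n \<otimes> x) \<le> ?b n" by simp
    have "filterlim (\<lambda>n. wd p (k n) - wd \<one> x) at_top sequentially"
      using filterlim_tendsto_add_at_top[OF tendsto_const[of "- wd \<one> x"] large] by (simp add: add.commute)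
    then have "filterlim (\<lambda>n. - \<gamma> * (wd p (k n) - wd \<one> x)) at_bot sequentially"
      using filterlim_tendsto_neg_mult_at_bot[OF tendsto_const[of "- \<gamma>"]] \<gamma> by simp
    then have "(\<lambda>n. exp (- \<gamma> * (wd p (k n) - wd \<one> x))) \<longlonglongrightarrow> 0"
      by (rule filterlim_compose[OF exp_at_bot])
    then show "?b \<longlonglongrightarrow> 0" using tendsto_mult_left[of _ 0 _ T] by fastforce
  qed auto
  moreover have "range k \<subseteq> S" using kS by blast
  ultimately show ?thesis using r(2) that[of k] k_def by simp
qed

text \<open>If \<open>k\<close> tends to infinity in the kernel and \<open>x\<close> is outside of it, then \<open>k n\<close> and
  \<open>k n \<otimes> x\<close> converge to the same boundary point while their images are constant and distinct.\<close>

lemma finite_kernel_if_continuous_extension: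
  assumes compl: "metric_completion_of d m' \<iota>" and \<phi>: "\<phi> \<in> hom G G" and nontriv: "\<phi> ` carrier G \<noteq> {\<one>}"
    and cont: "continuous_map (mtopology_of m') (mtopology_of m') \<Phi>" and ext: "extends_along d \<iota> \<phi> \<Phi>"
  shows "finite (kernel G G \<phi>)"
proof (rule ccontr)
  assume inf: "infinite (kernel G G \<phi>)"
  interpret group_hom G G \<phi> by unfold_locales (rule \<phi>)
  interpret Y: Metric_space "mspace m'" "mdist m'" by simp
  have \<iota>: "\<And>x. x \<in> carrier G \<Longrightarrow> \<iota> x \<in> mspace m'"
    "\<And>x y. x \<in> carrier G \<Longrightarrow> y \<in> carrier G \<Longrightarrow> mdist m' (\<iota> x) (\<iota> y) = mdist d x y"
    and complete: "Y.mcomplete"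
    using compl unfolding metric_completion_of_def mspace_d mcomplete_of_def by (auto simp: Pi_iff)
  have \<Phi>: "\<Phi> (\<iota> x) = \<iota> (\<phi> x)" if "x \<in> carrier G" for x
    using ext that unfolding extends_along_def mspace_d by blast
  obtain x where x: "x \<in> carrier G" "\<phi> x \<noteq> \<one>"
  proof (rule ccontr)
    assume "\<not> thesis"
    then have "\<And>x. x \<in> carrier G \<Longrightarrow> \<phi> x = \<one>" using that by blast
    then have "\<phi> ` carrier G = {\<one>}" using one_closed by force
    then show False using nontriv by contradiction
  qed
  have "kernel G G \<phi> \<subseteq> carrier G" unfolding kernel_def by blast
  with inf obtain k where k: "range k \<subseteq> kernel G G \<phi>" "V.MCauchy k"
    "\<forall>x\<in>carrier G. (\<lambda>n. mdist d (k n) (k n \<otimes> x)) \<longlonglongrightarrow> 0"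
    by (rule infinite_subset_Cauchy_sequence)
  have k1: "k n \<in> carrier G" "\<phi> (k n) = \<one>" for n using k(1) unfolding kernel_def by auto
  have "Y.MCauchy (\<lambda>n. \<iota> (k n))"
    using k(2) k1(1) \<iota> unfolding V.MCauchy_def Y.MCauchy_def by auto
  then obtain \<xi> where \<xi>: "limitin Y.mtopology (\<lambda>n. \<iota> (k n)) \<xi> sequentially"
    using complete unfolding Y.mcomplete_def by blast
  then have \<xi>M: "\<xi> \<in> mspace m'" and \<xi>0: "(\<lambda>n. mdist m' (\<iota> (k n)) \<xi>) \<longlonglongrightarrow> 0"
    unfolding Y.limitin_metric_dist_null by blast+
  have "(\<lambda>n. mdist m' (\<iota> (k n \<otimes> x)) \<xi>) \<longlonglongrightarrow> 0"
  proof (rule tendsto_sandwich[where f = "\<lambda>_. 0"])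
    have "mdist m' (\<iota> (k n \<otimes> x)) \<xi> \<le> mdist d (k n) (k n \<otimes> x) + mdist m' (\<iota> (k n)) \<xi>" for n
      using Y.triangle[of "\<iota> (k n \<otimes> x)" "\<iota> (k n)" \<xi>] \<iota> k1 x(1) \<xi>M V.commute[of "k n"] by simp
    then show "\<forall>\<^sub>F n in sequentially. mdist m' (\<iota> (k n \<otimes> x)) \<xi>
        \<le> mdist d (k n) (k n \<otimes> x) + mdist m' (\<iota> (k n)) \<xi>" by simp
    show "(\<lambda>n. mdist d (k n) (k n \<otimes> x) + mdist m' (\<iota> (k n)) \<xi>) \<longlonglongrightarrow> 0"
      using tendsto_add[OF bspec[OF k(3) x(1)] \<xi>0] by simp
  qed auto
  then have \<xi>': "limitin Y.mtopology (\<lambda>n. \<iota> (k n \<otimes> x)) \<xi> sequentially"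
    unfolding Y.limitin_metric_dist_null using \<xi>M \<iota>(1) k1(1) x(1) by simp
  have cont': "continuous_map Y.mtopology Y.mtopology \<Phi>" using cont unfolding mtopology_of_def .
  have "limitin Y.mtopology (\<lambda>n. \<iota> \<one>) (\<Phi> \<xi>) sequentially"
    using continuous_map_limit[OF cont' \<xi>] \<Phi> k1 by (simp add: o_def)
  moreover have "limitin Y.mtopology (\<lambda>n. \<iota> (\<phi> x)) (\<Phi> \<xi>) sequentially"
    using continuous_map_limit[OF cont' \<xi>'] \<Phi> k1 x(1) by (simp add: o_def)
  ultimately have "mdist m' (\<iota> \<one>) (\<Phi> \<xi>) = 0" "mdist m' (\<iota> (\<phi> x)) (\<Phi> \<xi>) = 0" "\<Phi> \<xi> \<in> mspace m'"
    unfolding Y.limitin_metric_dist_null by (simp_all add: LIMSEQ_const_iff)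
  then have "\<iota> \<one> = \<iota> (\<phi> x)" using \<iota>(1)[of \<one>] \<iota>(1)[of "\<phi> x"] x(1) by simp
  then have "mdist d \<one> (\<phi> x) = 0" using \<iota>(1)[of \<one>] \<iota>(2)[of \<one> "\<phi> x"] x(1) by simp
  then show False using x by simp
qed

end

section \<open>The equivalence\<close>

lemma (in group) torsion_free_finite_subgroup:
  assumes "torsion_free G" "subgroup H G" "finite H" shows "H = {\<one>}"
proof -
  have "g = \<one>" if g: "g \<in> H" for g
  proof -
    have gc: "g \<in> carrier G" using assms(2) g by (rule subgroup.mem_carrier)
    have "\<not> inj_on (\<lambda>n::nat. g [^] n) UNIV"
    proof
      assume "inj_on (\<lambda>n::nat. g [^] n) UNIV"
      moreover have "range (\<lambda>n::nat. g [^] n) \<subseteq> H"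
      proof clarify
        show "g [^] n \<in> H" for n :: nat
          by (induction n) (use g assms(2) in \<open>auto simp: subgroup.one_closed subgroup.m_closed\<close>)
      qed
      ultimately show False using assms(3) finite_imageD finite_subset infinite_UNIV_nat by blast
    qed
    then obtain i j :: nat where "i < j" "g [^] i = g [^] j"
      unfolding inj_on_def by (metis nat_neq_iff)
    then have "g [^] (j - i) = \<one>" using gc pow_eq_div2[of g j i] by simp
    then show ?thesis using assms(1) gc \<open>i < j\<close> unfolding torsion_free_def
      by (metis zero_less_diff)
  qed
  then show ?thesis using subgroup.one_closed[OF assms(2)] by blast
qed

theorem corollary5p4:
  fixes G :: "('a, 'm) monoid_scheme"
    and \<phi> :: "'a \<Rightarrow> 'a"
    and A :: "'a set" and p :: 'a and \<gamma> T :: real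
    and d :: "'a metric"
    and dhat :: "'b metric" and \<iota> :: "'a \<Rightarrow> 'b"
  assumes "hyperbolic_group G" and "torsion_free G" and "co_hopfian G"
    and "\<phi> \<in> hom G G" and "\<phi> ` carrier G \<noteq> {\<one>\<^bsub>G\<^esub>}"
    and "finite_generating_set G A" and "p \<in> carrier G" and "\<gamma> > 0" and "T \<ge> 1"
    and "d \<in> visual_metrics G A p \<gamma> T"
    and "metric_completion_of d dhat \<iota>"
  shows "all_equivalent
    [uniformly_continuous_map d d \<phi>,
     holder_map d d \<phi>,
     \<exists>\<Phi>. continuous_map (mtopology_of dhat) (mtopology_of dhat) \<Phi> \<and> extends_along d \<iota> \<phi> \<Phi>,
     \<exists>\<Phi>. holder_map dhat dhat \<Phi> \<and> extends_along d \<iota> \<phi> \<Phi>,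
     \<exists>P>0. \<exists>Q. \<forall>g\<in>carrier G. \<forall>h\<in>carrier G.
       P * gromov_product G A p (\<phi> g) (\<phi> h) + Q \<ge> gromov_product G A p g h,
     quasi_isometric_embedding (carrier G) (word_dist G A) (carrier G) (word_dist G A) \<phi>,
     virtually_injective G \<phi>,
     \<phi> \<in> iso G G]"
proof -
  \<comment> \<open>One cycle (i), (iii), (vii), (viii), (vi), (v), (ii), (i), with (iv) attached
    between (ii) and (iii).\<close>
  have cycle: "all_equivalent [a1, a2, a3, a4, a5, a6, a7, a8]"
    if "a1 \<Longrightarrow> a3" "a3 \<Longrightarrow> a7" "a7 \<Longrightarrow> a8" "a8 \<Longrightarrow> a6" "a6 \<Longrightarrow> a5" "a5 \<Longrightarrow> a2"
      "a2 \<Longrightarrow> a1" "a2 \<Longrightarrow> a4" "a4 \<Longrightarrow> a3" for a1 a2 a3 a4 a5 a6 a7 a8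
  proof -
    have "a1 = a2" "a3 = a2" "a4 = a2" "a5 = a2" "a6 = a2" "a7 = a2" "a8 = a2" using that by argo+
    then show ?thesis unfolding all_equivalent_def by simp
  qed
  interpret visual_metric G A p \<gamma> T d
    using assms unfolding visual_metric_def visual_metric_axioms_def fg_group_def fg_group_axioms_def
      hyperbolic_group_def by blast
  interpret group_hom G G \<phi> by unfold_locales (rule assms(4))
  show ?thesis
  proof (rule cycle)
    assume "uniformly_continuous_map d d \<phi>"
    then obtain \<Phi> where "uniformly_continuous_map dhat dhat \<Phi>" "extends_along d \<iota> \<phi> \<Phi>"
      by (rule uniformly_continuous_map_extends_to_completion[OF assms(11)])
    then show "\<exists>\<Phi>. continuous_map (mtopology_of dhat) (mtopology_of dhat) \<Phi> \<and> extends_along d \<iota> \<phi> \<Phi>"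
      using uniformly_continuous_imp_continuous_map by blast
  next
    assume "\<exists>\<Phi>. continuous_map (mtopology_of dhat) (mtopology_of dhat) \<Phi> \<and> extends_along d \<iota> \<phi> \<Phi>"
    then show "virtually_injective G \<phi>"
      unfolding virtually_injective_def
      using finite_kernel_if_continuous_extension[OF assms(11,4,5)] by blast
  next
    assume "virtually_injective G \<phi>"
    then have "kernel G G \<phi> = {\<one>\<^bsub>G\<^esub>}"
      unfolding virtually_injective_def
      by (rule torsion_free_finite_subgroup[OF assms(2) subgroup_kernel])
    then show "\<phi> \<in> iso G G"
      using assms(3,4) trivial_ker_imp_inj unfolding co_hopfian_def by blast
  next
    assume "\<phi> \<in> iso G G"
    then show "quasi_isometric_embedding (carrier G) wd (carrier G) wd \<phi>"
      by (rule iso_quasi_isometric)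
  next
    assume "quasi_isometric_embedding (carrier G) wd (carrier G) wd \<phi>"
    then show "\<exists>P>0. \<exists>Q. \<forall>g\<in>carrier G. \<forall>h\<in>carrier G.
        P * gromov_product G A p (\<phi> g) (\<phi> h) + Q \<ge> gromov_product G A p g h"
      by (rule gromov_product_le_if_quasi_isometric[OF assms(1,7)])
  next
    assume "\<exists>P>0. \<exists>Q. \<forall>g\<in>carrier G. \<forall>h\<in>carrier G.
        P * gromov_product G A p (\<phi> g) (\<phi> h) + Q \<ge> gromov_product G A p g h"
    then obtain P Q where "P > 0" and "\<And>g h. g \<in> carrier G \<Longrightarrow> h \<in> carrier G \<Longrightarrow>
        gromov_product G A p g h \<le> P * gromov_product G A p (\<phi> g) (\<phi> h) + Q" by blast
    then show "holder_map d d \<phi>" by (intro holder_map_if_gromov_product_le[of \<phi> P Q]) auto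
  next
    assume "holder_map d d \<phi>"
    then show "uniformly_continuous_map d d \<phi>" by (rule holder_map_imp_uniformly_continuous_map)
  next
    assume "holder_map d d \<phi>"
    then obtain \<Phi> where "holder_map dhat dhat \<Phi>" "extends_along d \<iota> \<phi> \<Phi>"
      by (rule holder_map_extends_to_completion[OF assms(11)])
    then show "\<exists>\<Phi>. holder_map dhat dhat \<Phi> \<and> extends_along d \<iota> \<phi> \<Phi>" by blast
  next
    assume "\<exists>\<Phi>. holder_map dhat dhat \<Phi> \<and> extends_along d \<iota> \<phi> \<Phi>"
    then show "\<exists>\<Phi>. continuous_map (mtopology_of dhat) (mtopology_of dhat) \<Phi> \<and> extends_along d \<iota> \<phi> \<Phi>"
      using holder_map_imp_uniformly_continuous_map uniformly_continuous_imp_continuous_map by blast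
  qed
qed

end
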